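(* Let $\Omega$ be a bounded pseudoconvex domain in $\mathbb{C}^n$, let $0\leq p\leq n$ and $1\leq q\leq n$ be integers, and let $\phi\in C(\Omega)\cap L^\infty(\Omega)$. Then the following are equivalent: (i) the multiplication operator $M^{p,q}_\phi$ is compact on $K^2_{(p,q)}(\Omega)$; (ii) the Toeplitz operator $T^{p,q}_\phi$ is compact on $K^2_{(p,q)}(\Omega)$; (iii) $\phi=0$ on $\Omega$.
   Context: $L^2_{(p,q)}(\Omega)$ is the Hilbert space of $(p,q)$-forms on $\Omega$ with square integrable coefficients (Lebesgue measure), and $K^2_{(p,q)}(\Omega)\subset L^2_{(p,q)}(\Omega)$ is the closed subspace of $\overline{\partial}$-closed forms ($\overline{\partial}$ in the sense of distributions). $P^{p,q}:L^2_{(p,q)}(\Omega)\to K^2_{(p,q)}(\Omega)$ is the orthogonal projection. For $\phi\in L^\infty(\Omega)$, $M^{p,q}_\phi:K^2_{(p,q)}(\Omega)\to L^2_{(p,q)}(\Omega)$ is $M^{p,q}_\phi f=\phi f$, and $T^{p,q}_\phi:K^2_{(p,q)}(\Omega)\to K^2_{(p,q)}(\Omega)$ is $T^{p,q}_\phi f=P^{p,q}(\phi f)$. *)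

theory Defs
  imports "HOL-Analysis.Analysis"
begin

type_synonym 'n cspace = "(complex, 'n) vec"

section \<open>Pseudoconvex domains\<close>

text \<open>
  Plurisubharmonicity is stated as the sub-mean-value property on every closed disc of a complex
  line contained in the domain; pseudoconvexity as the existence of a continuous
  plurisubharmonic exhaustion function.
\<close>

definition continuous_psh_on :: "('n::finite) cspace set \<Rightarrow> ('n cspace \<Rightarrow> real) \<Rightarrow> bool" where
  "continuous_psh_on \<Omega> u \<longleftrightarrow> continuous_on \<Omega> u \<and>
     (\<forall>z w. (\<forall>\<tau>. cmod \<tau> \<le> 1 \<longrightarrow> z + \<tau> *s w \<in> \<Omega>) \<longrightarrow>
        u z \<le> integral {0..2 * pi} (\<lambda>t. u (z + cis t *s w)) / (2 * pi))"

definition pseudoconvex_domain :: "('n::finite) cspace set \<Rightarrow> bool" where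
  "pseudoconvex_domain \<Omega> \<longleftrightarrow> open \<Omega> \<and> connected \<Omega> \<and> \<Omega> \<noteq> {} \<and>
     (\<exists>u. continuous_psh_on \<Omega> u \<and>
        (\<forall>c. compact (closure {z \<in> \<Omega>. u z < c}) \<and> closure {z \<in> \<Omega>. u z < c} \<subseteq> \<Omega>))"

section \<open>Test functions\<close>

primrec C_k :: "nat \<Rightarrow> ('a::real_normed_vector \<Rightarrow> 'b::real_normed_vector) \<Rightarrow> bool" where
  "C_k 0 f \<longleftrightarrow> continuous_on UNIV f"
| "C_k (Suc k) f \<longleftrightarrow> (\<forall>x. f differentiable (at x)) \<and>
     (\<forall>v. C_k k (\<lambda>x. frechet_derivative f (at x) v))"

definition test_function :: "('n::finite) cspace set \<Rightarrow> ('n cspace \<Rightarrow> complex) \<Rightarrow> bool" where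
  "test_function \<Omega> \<psi> \<longleftrightarrow> (\<forall>k. C_k k \<psi>) \<and>
     compact (closure {z. \<psi> z \<noteq> 0}) \<and> closure {z. \<psi> z \<noteq> 0} \<subseteq> \<Omega>"

text \<open>The Wirtinger derivative with respect to the conjugate of the \<open>k\<close>-th coordinate.\<close>

definition d_zbar :: "'n::finite \<Rightarrow> ('n cspace \<Rightarrow> complex) \<Rightarrow> 'n cspace \<Rightarrow> complex" where
  "d_zbar k \<psi> z = (frechet_derivative \<psi> (at z) (axis k 1)
                  + \<i> * frechet_derivative \<psi> (at z) (axis k \<i>)) / 2"

section \<open>Square integrable forms\<close>

text \<open>
  The value \<open>f z I J\<close> is the coefficient at \<open>z\<close> of the monomial dz_I wedge dzbar_J, where the
  increasing multi-indices are encoded as subsets of the linearly ordered index type.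
  Forms are pointwise representatives; equality in the Hilbert space is equality almost
  everywhere, i.e. vanishing of \<open>L2_norm\<close> of the difference.
\<close>

type_synonym 'n form = "'n cspace \<Rightarrow> 'n set \<Rightarrow> 'n set \<Rightarrow> complex"

definition form_diff :: "'n form \<Rightarrow> 'n form \<Rightarrow> 'n form" where
  "form_diff f g = (\<lambda>z I J. f z I J - g z I J)"

definition L2 :: "('n::finite) cspace set \<Rightarrow> nat \<Rightarrow> nat \<Rightarrow> 'n form set" where
  "L2 \<Omega> p q = {f.
     (\<forall>z I J. \<not> (card I = p \<and> card J = q) \<longrightarrow> f z I J = 0) \<and>
     (\<forall>I J. (\<lambda>z. f z I J) \<in> borel_measurable (lebesgue_on \<Omega>) \<and>
            integrable (lebesgue_on \<Omega>) (\<lambda>z. (cmod (f z I J))\<^sup>2))}"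

definition L2_inner ::
  "('n::finite) cspace set \<Rightarrow> nat \<Rightarrow> nat \<Rightarrow> 'n form \<Rightarrow> 'n form \<Rightarrow> complex" where
  "L2_inner \<Omega> p q f g =
     (\<Sum>I | card I = p. \<Sum>J | card J = q. LINT z|lebesgue_on \<Omega>. f z I J * cnj (g z I J))"

definition L2_norm :: "('n::finite) cspace set \<Rightarrow> nat \<Rightarrow> nat \<Rightarrow> 'n form \<Rightarrow> real" where
  "L2_norm \<Omega> p q f =
     sqrt (\<Sum>I | card I = p. \<Sum>J | card J = q. LINT z|lebesgue_on \<Omega>. (cmod (f z I J))\<^sup>2)"

text \<open>
  For a \<open>(p,q)\<close>-form \<open>f\<close>, the distribution that is the dz_I wedge dzbar_K coefficient of dbar f
  (\<open>card I = p\<close>, \<open>card K = q + 1\<close>), applied to the test function \<open>\<psi>\<close>. For \<open>k \<in> K\<close>, the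
  product dzbar_k wedge dz_I wedge dzbar_(K - {k}) equals \<open>(-1) ^ p * (-1) ^ card {j \<in> K. j < k}\<close>
  times dz_I wedge dzbar_K; the minus sign in front of the integral is that of the
  distributional derivative.
\<close>

definition dbar_dist ::
  "('n::{finite,linorder}) cspace set \<Rightarrow> nat \<Rightarrow> 'n form \<Rightarrow> 'n set \<Rightarrow> 'n set
     \<Rightarrow> ('n cspace \<Rightarrow> complex) \<Rightarrow> complex" where
  "dbar_dist \<Omega> p f I K \<psi> =
     (-1) ^ p * (\<Sum>k\<in>K. (-1) ^ card {j \<in> K. j < k} *
       (- (LINT z|lebesgue_on \<Omega>. f z I (K - {k}) * d_zbar k \<psi> z)))"

definition K2 :: "('n::{finite,linorder}) cspace set \<Rightarrow> nat \<Rightarrow> nat \<Rightarrow> 'n form set" where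
  "K2 \<Omega> p q = {f \<in> L2 \<Omega> p q. \<forall>I K \<psi>. card I = p \<longrightarrow> card K = q + 1 \<longrightarrow>
     test_function \<Omega> \<psi> \<longrightarrow> dbar_dist \<Omega> p f I K \<psi> = 0}"

section \<open>Operators\<close>

definition Linfty :: "('n::finite) cspace set \<Rightarrow> ('n cspace \<Rightarrow> complex) set" where
  "Linfty \<Omega> = {\<phi>. \<phi> \<in> borel_measurable (lebesgue_on \<Omega>) \<and>
     (\<exists>C. AE z in lebesgue_on \<Omega>. cmod (\<phi> z) \<le> C)}"

text \<open>
  The projection is determined up to equality almost everywhere; \<open>SOME\<close> chooses a representative.
\<close>

definition proj_K2 ::
  "('n::{finite,linorder}) cspace set \<Rightarrow> nat \<Rightarrow> nat \<Rightarrow> 'n form \<Rightarrow> 'n form" where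
  "proj_K2 \<Omega> p q f =
     (SOME g. g \<in> K2 \<Omega> p q \<and> (\<forall>h \<in> K2 \<Omega> p q. L2_inner \<Omega> p q (form_diff f g) h = 0))"

definition mult_op :: "('n cspace \<Rightarrow> complex) \<Rightarrow> 'n form \<Rightarrow> 'n form" where
  "mult_op \<phi> f = (\<lambda>z I J. \<phi> z * f z I J)"

definition toeplitz_op ::
  "('n::{finite,linorder}) cspace set \<Rightarrow> nat \<Rightarrow> nat \<Rightarrow> ('n cspace \<Rightarrow> complex)
     \<Rightarrow> 'n form \<Rightarrow> 'n form" where
  "toeplitz_op \<Omega> p q \<phi> f = proj_K2 \<Omega> p q (mult_op \<phi> f)"

text \<open>
  Compactness of an operator between subspaces \<open>V\<close> and \<open>W\<close> of the space of square integrable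
  \<open>(p,q)\<close>-forms: images of bounded sequences have subsequences converging in \<open>W\<close>.
\<close>

definition compact_op ::
  "('n::finite) cspace set \<Rightarrow> nat \<Rightarrow> nat \<Rightarrow> 'n form set \<Rightarrow> 'n form set
     \<Rightarrow> ('n form \<Rightarrow> 'n form) \<Rightarrow> bool" where
  "compact_op \<Omega> p q V W T \<longleftrightarrow> T ` V \<subseteq> W \<and>
     (\<forall>F C. (\<forall>j::nat. F j \<in> V \<and> L2_norm \<Omega> p q (F j) \<le> C) \<longrightarrow>
       (\<exists>g \<in> W. \<exists>r::nat \<Rightarrow> nat. strict_mono r \<and>
          (\<lambda>j. L2_norm \<Omega> p q (form_diff (T (F (r j))) g)) \<longlonglongrightarrow> 0))"

end

theory Submission imports Defs begin

text \<open>
  Since \<open>q \<ge> 1\<close>, the space of closed forms contains dbar of every compactly supported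
  \<open>(p, q - 1)\<close>-form, hence unit vectors \<open>f\<^sub>n\<close> supported in balls shrinking to any given
  point \<open>c\<close>; these converge weakly to 0. If \<open>T\<close> is compact and \<open>\<langle>T f, f\<rangle> = \<langle>\<phi> f, f\<rangle>\<close> for closed \<open>f\<close> (true for the multiplication and
  for the Toeplitz operator), then \<open>\<langle>\<phi> f\<^sub>n, f\<^sub>n\<rangle> \<rightarrow> 0\<close>, while continuity of \<open>\<phi>\<close> gives
  \<open>\<langle>\<phi> f\<^sub>n, f\<^sub>n\<rangle> \<rightarrow> \<phi> c\<close>.
\<close>

section \<open>Square integrable functions\<close>

text \<open>Forms are representatives and carry no Hilbert space type, so completeness,
  Cauchy-Schwarz and the orthogonal projection are established by hand; without an existence proof
  the \<open>SOME\<close> in \<open>proj_K2\<close> says nothing. Weak convergence is never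
  formulated: if T f_n tends to g along a subsequence, <T f_n, f_n> splits into <T f_n - g, f_n>,
  small by compactness, and <g, f_n>, at most the norm of g on the shrinking ball. The limit g never
  has to be identified. The potential of f_n is the square of the positive part of r^2 - |z - c|^2,
  which is only C1 but has an explicit dbar. The price is that dbar dbar = 0 cannot be read off from
  symmetric second derivatives; it is proved weakly, through translation invariance. For q = 0 the
  construction breaks down: closed forms then have holomorphic coefficients up to null sets, and a
  nonzero continuous \<phi> with compact support in \<Omega> gives compact operators by Montel's
  theorem.\<close>

definition square_integrable :: "'a measure \<Rightarrow> ('a \<Rightarrow> complex) \<Rightarrow> bool" where
  "square_integrable M f \<longleftrightarrow>
     f \<in> borel_measurable M \<and> integrable M (\<lambda>x. (cmod (f x))\<^sup>2)"

lemma square_integrable_zero [simp]: "square_integrable M (\<lambda>x. 0)"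
  by (simp add: square_integrable_def)

lemma square_integrable_cmult:
  "square_integrable M f \<Longrightarrow> square_integrable M (\<lambda>x. c * f x)"
  by (auto simp: square_integrable_def norm_mult power_mult_distrib)

lemma norm_mult_le_sum_squares:
  "norm (a * b :: 'a::real_normed_div_algebra) \<le> (norm a)\<^sup>2 + (norm b)\<^sup>2"
proof -
  have "2 * norm a * norm b \<le> (norm a)\<^sup>2 + (norm b)\<^sup>2" by (rule sum_squares_bound)
  moreover have "0 \<le> norm a * norm b" by simp
  ultimately show ?thesis unfolding norm_mult by linarith
qed

lemma square_integrable_mult_integrable:
  assumes "square_integrable M f" "square_integrable M g"
  shows "integrable M (\<lambda>x. f x * g x)"
proof (rule Bochner_Integration.integrable_bound)
  show "integrable M (\<lambda>x. (cmod (f x))\<^sup>2 + (cmod (g x))\<^sup>2)"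
    using assms by (auto simp: square_integrable_def)
  show "(\<lambda>x. f x * g x) \<in> borel_measurable M"
    using assms by (auto simp: square_integrable_def)
  show "AE x in M. norm (f x * g x) \<le> norm ((cmod (f x))\<^sup>2 + (cmod (g x))\<^sup>2)"
    by (intro always_eventually allI order_trans[OF norm_mult_le_sum_squares]) simp
qed

lemma square_integrable_cnj:
  "square_integrable M f \<Longrightarrow> square_integrable M (\<lambda>x. cnj (f x))"
  unfolding square_integrable_def
  by (auto intro!: borel_measurable_continuous_on[where f=cnj] continuous_intros)

lemma square_integrable_add:
  assumes "square_integrable M f" "square_integrable M g"
  shows "square_integrable M (\<lambda>x. f x + g x)"
  unfolding square_integrable_def
proof (rule conjI[OF _ Bochner_Integration.integrable_bound])
  show m: "(\<lambda>x. f x + g x) \<in> borel_measurable M"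
    using assms by (auto simp: square_integrable_def)
  show "integrable M (\<lambda>x. 2 * (cmod (f x))\<^sup>2 + 2 * (cmod (g x))\<^sup>2)"
    using assms by (auto simp: square_integrable_def)
  show "(\<lambda>x. (cmod (f x + g x))\<^sup>2) \<in> borel_measurable M" using m by simp
  have "(cmod (a + b))\<^sup>2 \<le> 2 * (cmod a)\<^sup>2 + 2 * (cmod b)\<^sup>2" for a b
  proof -
    have "(cmod (a + b))\<^sup>2 \<le> (cmod a + cmod b)\<^sup>2"
      by (simp add: norm_triangle_ineq power_mono)
    also have "\<dots> \<le> 2 * (cmod a)\<^sup>2 + 2 * (cmod b)\<^sup>2"
      using sum_squares_bound[of "cmod a" "cmod b"] by (simp add: power2_sum)
    finally show ?thesis .
  qed
  then show "AE x in M. norm ((cmod (f x + g x))\<^sup>2) \<le> norm (2 * (cmod (f x))\<^sup>2 + 2 * (cmod (g x))\<^sup>2)"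
    by (intro always_eventually) (smt (verit) real_norm_def zero_le_power2)
qed

lemma square_integrable_diff:
  assumes "square_integrable M f" "square_integrable M g"
  shows "square_integrable M (\<lambda>x. f x - g x)"
  using square_integrable_add[OF assms(1) square_integrable_cmult[OF assms(2), of "-1"]] by simp

lemma square_integrable_bounded_mult:
  assumes f: "square_integrable M f" and g: "g \<in> borel_measurable M"
    and bound: "AE x in M. cmod (g x) \<le> C"
  shows "square_integrable M (\<lambda>x. g x * f x)"
  unfolding square_integrable_def
proof (rule conjI[OF _ Bochner_Integration.integrable_bound])
  show m: "(\<lambda>x. g x * f x) \<in> borel_measurable M"
    using f g by (auto simp: square_integrable_def)
  show "integrable M (\<lambda>x. C\<^sup>2 * (cmod (f x))\<^sup>2)"
    using f by (auto simp: square_integrable_def)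
  show "(\<lambda>x. (cmod (g x * f x))\<^sup>2) \<in> borel_measurable M" using m by simp
  show "AE x in M. norm ((cmod (g x * f x))\<^sup>2) \<le> norm (C\<^sup>2 * (cmod (f x))\<^sup>2)"
    using bound
    by eventually_elim (auto simp: norm_mult power_mult_distrib intro!: mult_right_mono power_mono)
qed

section \<open>Riesz-Fischer completeness over a finite measure\<close>

text \<open>Finiteness of the measure turns the square bounds on the increments into bounds (measure
  + 1) * 2^-k on the integrals of their absolute values. These are summable, so almost everywhere
  the increments are absolutely summable and the telescoping series converges.\<close>

lemma rapidly_Cauchy_AE_convergent:
  assumes M: "finite_measure M"
    and G: "\<And>k. square_integrable M (G k)"
    and small: "\<And>k. (LINT x|M. (cmod (G (Suc k) x - G k x))\<^sup>2) \<le> (1/4) ^ k"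
  shows "AE x in M. convergent (\<lambda>k. G k x)"
proof -
  interpret finite_measure M by fact
  define h where "h k x = cmod (G (Suc k) x - G k x)" for k x
  have sq: "square_integrable M (\<lambda>x. G (Suc k) x - G k x)" for k
    using G by (intro square_integrable_diff)
  have [measurable]: "h k \<in> borel_measurable M" for k
    using sq[of k] unfolding h_def square_integrable_def by (auto intro!: borel_measurable_norm)
  have h2: "integrable M (\<lambda>x. (h k x)\<^sup>2)" for k
    using sq[of k] unfolding h_def square_integrable_def by simp
  \<comment> \<open>Weighted arithmetic-geometric inequality replacing Hoelder: the weight 2^k
    balances the bound 4^-k on the integral of the square, so that both terms contribute a multiple
    of 2^-k.\<close>
  have le: "h k x \<le> (1/2)^k + 2^k * (h k x)\<^sup>2" for k x
  proof -
    have "0 \<le> ((1/2)^k - h k x)\<^sup>2 + (1/2)^k * h k x" by (simp add: h_def)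
    then have "0 \<le> 2^k * (((1/2)^k - h k x)\<^sup>2 + (1/2)^k * h k x)" by simp
    also have "\<dots> = (1/2)^k + 2^k * (h k x)\<^sup>2 - h k x"
      by (simp add: power2_eq_square algebra_simps power_one_over divide_simps)
    finally show ?thesis by simp
  qed
  have int_le: "integrable M (\<lambda>x. (1/2)^k + 2^k * (h k x)\<^sup>2)" for k
    using h2 by auto
  have "(\<integral>\<^sup>+x. ennreal (h k x) \<partial>M) \<le> ennreal ((measure M (space M) + 1) * (1/2)^k)" for k
  proof -
    have "(\<integral>\<^sup>+x. ennreal (h k x) \<partial>M) \<le> (\<integral>\<^sup>+x. ennreal ((1/2)^k + 2^k * (h k x)\<^sup>2) \<partial>M)"
      by (intro nn_integral_mono ennreal_leI le)
    also have "\<dots> = ennreal (LINT x|M. (1/2)^k + 2^k * (h k x)\<^sup>2)"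
      by (intro nn_integral_eq_integral int_le always_eventually) auto
    also have "(LINT x|M. (1/2)^k + 2^k * (h k x)\<^sup>2)
        = (1/2)^k * measure M (space M) + 2^k * (LINT x|M. (h k x)\<^sup>2)"
      using h2 by (subst Bochner_Integration.integral_add) auto
    also have "\<dots> \<le> (1/2)^k * measure M (space M) + 2^k * (1/4)^k"
      using small[of k] by (simp add: h_def)
    also have "\<dots> = (measure M (space M) + 1) * (1/2)^k"
      by (simp add: algebra_simps flip: power_mult_distrib)
    finally show ?thesis using ennreal_leI by simp
  qed
  then have "(\<integral>\<^sup>+x. (\<Sum>k. ennreal (h k x)) \<partial>M)
      \<le> (\<Sum>k. ennreal ((measure M (space M) + 1) * (1/2)^k))"
    by (subst nn_integral_suminf) (auto intro!: suminf_le)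
  also have "\<dots> = ennreal (\<Sum>k. (measure M (space M) + 1) * (1/2)^k)"
    by (intro suminf_ennreal2 summable_mult) (auto intro: summable_geometric)
  finally have "(\<integral>\<^sup>+x. (\<Sum>k. ennreal (h k x)) \<partial>M) \<noteq> \<infinity>"
    using ennreal_less_top le_less_trans by (metis infinity_ennreal_def less_irrefl)
  then have "AE x in M. (\<Sum>k. ennreal (h k x)) \<noteq> \<infinity>"
    by (intro nn_integral_noteq_infinite) auto
  then show ?thesis
  proof eventually_elim
    case (elim x)
    then have "summable (\<lambda>k. h k x)"
      by (intro summable_suminf_not_top) (auto simp: h_def)
    then have "summable (\<lambda>k. G (Suc k) x - G k x)"
      unfolding h_def by (rule summable_norm_cancel)
    then have "convergent (\<lambda>n. (\<Sum>k<n. G (Suc k) x - G k x) + G 0 x)"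
      by (intro convergent_add convergent_const) (simp add: summable_iff_convergent)
    moreover have "(\<Sum>k<n. G (Suc k) x - G k x) + G 0 x = G n x" for n
      using sum_lessThan_telescope[of "\<lambda>k. G k x" n] by (simp only: diff_add_cancel)
    ultimately show ?case by (simp only:)
  qed
qed

lemma square_integrable_complete:
  assumes M: "finite_measure M" and F: "\<And>n. square_integrable M (F n)"
    and Cauchy: "\<And>e. e > 0 \<Longrightarrow>
      \<exists>N. \<forall>m\<ge>N. \<forall>n\<ge>N. (LINT x|M. (cmod (F m x - F n x))\<^sup>2) < e"
  obtains f where "square_integrable M f"
    "(\<lambda>n. LINT x|M. (cmod (F n x - f x))\<^sup>2) \<longlonglongrightarrow> 0"
proof -
  have "\<exists>N. \<forall>m\<ge>N. \<forall>n\<ge>N. (LINT x|M. (cmod (F m x - F n x))\<^sup>2) < (1/4)^k" for k :: nat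
    using Cauchy[of "(1/4)^k"] by simp
  then obtain N where N: "\<And>k m n. N k \<le> m \<Longrightarrow> N k \<le> n \<Longrightarrow>
      (LINT x|M. (cmod (F m x - F n x))\<^sup>2) < (1/4)^k" by metis
  \<comment> \<open>The partial sum of N puts \<open>r k\<close> beyond \<open>N k\<close> and makes
    r monotone; the summand k makes it tend to infinity, as the Fatou argument needs.\<close>
  define r where "r k = k + (\<Sum>i\<le>k. N i)" for k
  have rN: "N k \<le> r k" for k
    unfolding r_def by (rule trans_le_add2) (simp add: member_le_sum)
  have rmono: "r k \<le> r (Suc k)" for k unfolding r_def by simp
  have rge: "k \<le> r k" for k unfolding r_def by simp
  define G where "G k = F (r k)" for k
  have G: "square_integrable M (G k)" for k unfolding G_def by (rule F)
  have [measurable]: "G k \<in> borel_measurable M" "F k \<in> borel_measurable M" for k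
    using G F by (auto simp: square_integrable_def)
  have conv: "AE x in M. convergent (\<lambda>k. G k x)"
  proof (rule rapidly_Cauchy_AE_convergent[OF M G])
    show "(LINT x|M. (cmod (G (Suc k) x - G k x))\<^sup>2) \<le> (1/4)^k" for k
      unfolding G_def using N[of k "r (Suc k)" "r k"] rN[of k] rmono[of k] by simp
  qed
  define f where "f x = lim (\<lambda>k. G k x)" for x
  have f_meas [measurable]: "f \<in> borel_measurable M"
    unfolding f_def by (rule borel_measurable_lim_metric) simp
  have lim: "AE x in M. (\<lambda>k. G k x) \<longlonglongrightarrow> f x"
    using conv by eventually_elim (simp add: f_def convergent_LIMSEQ_iff)
  \<comment> \<open>Fatou's lemma with n fixed and the subsequence G running: this carries the
    Cauchy estimate from the subsequence to the distance of the whole sequence from its limit.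
    Integrability of F n - f is a consequence, hence the nonnegative integral.\<close>
  have bound: "(\<integral>\<^sup>+x. ennreal ((cmod (F n x - f x))\<^sup>2) \<partial>M) \<le> ennreal e"
    if N0: "\<And>m n. N0 \<le> m \<Longrightarrow> N0 \<le> n \<Longrightarrow> (LINT x|M. (cmod (F m x - F n x))\<^sup>2) < e"
      and n: "N0 \<le> n" for e N0 n
  proof -
    have "(\<integral>\<^sup>+x. ennreal ((cmod (F n x - f x))\<^sup>2) \<partial>M)
        = (\<integral>\<^sup>+x. liminf (\<lambda>k. ennreal ((cmod (F n x - G k x))\<^sup>2)) \<partial>M)"
    proof (rule nn_integral_cong_AE, use lim in eventually_elim)
      case (elim x)
      then have "(\<lambda>k. ennreal ((cmod (F n x - G k x))\<^sup>2))
          \<longlonglongrightarrow> ennreal ((cmod (F n x - f x))\<^sup>2)"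
        by (intro tendsto_intros tendsto_ennrealI)
      then show ?case by (intro lim_imp_Liminf[symmetric]) auto
    qed
    also have "\<dots> \<le> liminf (\<lambda>k. \<integral>\<^sup>+x. ennreal ((cmod (F n x - G k x))\<^sup>2) \<partial>M)"
      by (rule nn_integral_liminf) simp
    also have "\<dots> \<le> ennreal e"
    proof -
      have "(\<integral>\<^sup>+x. ennreal ((cmod (F n x - G k x))\<^sup>2) \<partial>M) \<le> ennreal e" if "N0 \<le> k" for k
      proof -
        have "integrable M (\<lambda>x. (cmod (F n x - G k x))\<^sup>2)"
          using square_integrable_diff[OF F G] by (auto simp: square_integrable_def)
        then have "(\<integral>\<^sup>+x. ennreal ((cmod (F n x - G k x))\<^sup>2) \<partial>M)
            = ennreal (LINT x|M. (cmod (F n x - G k x))\<^sup>2)"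
          by (intro nn_integral_eq_integral) auto
        also have "\<dots> \<le> ennreal e"
          unfolding G_def using N0[OF n, of "r k"] rge[of k] that by (intro ennreal_leI) simp
        finally show ?thesis .
      qed
      then have "eventually (\<lambda>k. (\<integral>\<^sup>+x. ennreal ((cmod (F n x - G k x))\<^sup>2) \<partial>M) \<le> ennreal e) sequentially"
        by (auto simp: eventually_sequentially)
      then show ?thesis by (simp add: Liminf_le)
    qed
    finally show ?thesis .
  qed
  have diff: "square_integrable M (\<lambda>x. F n x - f x) \<and> (LINT x|M. (cmod (F n x - f x))\<^sup>2) \<le> e"
    if N0: "\<And>m n. N0 \<le> m \<Longrightarrow> N0 \<le> n \<Longrightarrow> (LINT x|M. (cmod (F m x - F n x))\<^sup>2) < e"
      and n: "N0 \<le> n" and e: "0 < e" for e N0 n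
  proof
    note b = bound[OF N0 n]
    show sq: "square_integrable M (\<lambda>x. F n x - f x)"
      unfolding square_integrable_def
      using b by (auto simp: integrable_iff_bounded intro: le_less_trans)
    have "ennreal (LINT x|M. (cmod (F n x - f x))\<^sup>2) \<le> ennreal e"
      using b sq by (subst nn_integral_eq_integral[symmetric]) (auto simp: square_integrable_def)
    then show "(LINT x|M. (cmod (F n x - f x))\<^sup>2) \<le> e" using e by simp
  qed
  obtain N1 where "\<And>m n. N1 \<le> m \<Longrightarrow> N1 \<le> n \<Longrightarrow> (LINT x|M. (cmod (F m x - F n x))\<^sup>2) < 1"
    using Cauchy[of 1] by auto
  then have "square_integrable M (\<lambda>x. F N1 x - f x)" using diff by force
  \<comment> \<open>f is recovered as F N1 - (F N1 - f).\<close>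
  from square_integrable_diff[OF F[of N1] this] have "square_integrable M f" by simp
  moreover have "(\<lambda>n. LINT x|M. (cmod (F n x - f x))\<^sup>2) \<longlonglongrightarrow> 0"
  proof (rule LIMSEQ_I)
    fix e :: real assume "0 < e"
    then obtain N0 where "\<And>m n. N0 \<le> m \<Longrightarrow> N0 \<le> n \<Longrightarrow> (LINT x|M. (cmod (F m x - F n x))\<^sup>2) < e/2"
      using Cauchy[of "e/2"] by auto
    then have "(LINT x|M. (cmod (F n x - f x))\<^sup>2) \<le> e/2" if "n \<ge> N0" for n
      using diff[of N0 "e/2" n] that \<open>0 < e\<close> by auto
    then show "\<exists>n0. \<forall>n\<ge>n0. norm ((LINT x|M. (cmod (F n x - f x))\<^sup>2) - 0) < e"
      using \<open>0 < e\<close> by (intro exI[of _ N0]) (fastforce simp: abs_of_nonneg)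
  qed
  ultimately show thesis by (rule that)
qed

section \<open>Cauchy-Schwarz from a nonnegative quadratic expression\<close>

text \<open>Stated for numbers so that it serves three times: for integrals, for forms, and with A =
  0 to turn minimal distance into orthogonality.\<close>

lemma Cauchy_Schwarz_discriminant:
  fixes A B :: real and c :: complex
  assumes nonneg: "\<And>a. 0 \<le> A + 2 * Re (cnj a * c) + (cmod a)\<^sup>2 * B" and B: "0 \<le> B"
  shows "(cmod c)\<^sup>2 \<le> A * B"
proof (cases "B = 0")
  case True
  have "c = 0"
  proof (rule ccontr)
    assume "c \<noteq> 0"
    \<comment> \<open>With B = 0 the expression is affine along real multiples of c; this s brings
      it to the value -1.\<close>
    define s where "s = - ((A + 1) / (2 * (cmod c)\<^sup>2))"
    have "Re (cnj (of_real s * c) * c) = s * (cmod c)\<^sup>2"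
      unfolding cmod_power2 by (simp add: power2_eq_square algebra_simps)
    then have "0 \<le> A + 2 * (s * (cmod c)\<^sup>2)"
      using nonneg[of "of_real s * c"] True by (simp only: mult_zero_right add_0_right)
    also have "A + 2 * (s * (cmod c)\<^sup>2) = -1"
      using \<open>c \<noteq> 0\<close> by (simp add: s_def field_simps)
    finally show False by simp
  qed
  then show ?thesis using True by simp
next
  case False
  \<comment> \<open>The value a = -c/B minimizes the expression.\<close>
  have "Re (cnj (of_real (- 1 / B) * c) * c) = - 1 / B * (cmod c)\<^sup>2"
    unfolding cmod_power2 by (simp add: power2_eq_square algebra_simps add_divide_distrib)
  moreover have "(cmod (of_real (- 1 / B) * c))\<^sup>2 * B = (cmod c)\<^sup>2 / B"
    using False B by (simp add: norm_mult norm_divide power_mult_distrib power_divide power2_eq_square[of B])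
  ultimately have "0 \<le> A + 2 * (- 1 / B * (cmod c)\<^sup>2) + (cmod c)\<^sup>2 / B"
    using nonneg[of "of_real (- 1 / B) * c"] by (simp only:)
  then have "(cmod c)\<^sup>2 / B \<le> A" by simp
  then show ?thesis using False B by (simp add: divide_le_eq)
qed

lemma integral_norm_add_cmult_square:
  assumes f: "square_integrable M f" and g: "square_integrable M g"
  shows "(LINT x|M. (cmod (f x + a * g x))\<^sup>2) = (LINT x|M. (cmod (f x))\<^sup>2)
    + 2 * Re (cnj a * (LINT x|M. f x * cnj (g x))) + (cmod a)\<^sup>2 * (LINT x|M. (cmod (g x))\<^sup>2)"
proof -
  have fg: "integrable M (\<lambda>x. f x * cnj (g x))"
    by (intro square_integrable_mult_integrable square_integrable_cnj f g)
  have eq: "(cmod (u + a * v))\<^sup>2 = (cmod u)\<^sup>2 + 2 * Re (cnj a * (u * cnj v)) + (cmod a)\<^sup>2 * (cmod v)\<^sup>2"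
    for u v
    unfolding cmod_power2 by (simp add: power2_eq_square algebra_simps)
  have ints: "integrable M (\<lambda>x. (cmod (f x))\<^sup>2)" "integrable M (\<lambda>x. (cmod (g x))\<^sup>2)"
    "integrable M (\<lambda>x. Re (cnj a * (f x * cnj (g x))))"
    using f g by (auto simp only: square_integrable_def intro!: integrable_Re integrable_mult_right fg)
  have "(LINT x|M. Re (cnj a * (f x * cnj (g x)))) = Re (cnj a * (LINT x|M. f x * cnj (g x)))"
    using fg by (simp only: integral_Re integrable_mult_right integral_mult_right_zero)
  with ints show ?thesis unfolding eq by (simp del: times_complex.sel)
qed

text \<open>No conjugate on g, because distributions pair \<open>f\<close> with
  \<open>d_zbar k \<psi>\<close> bilinearly; the hermitian version is applied to the conjugate of
  g.\<close>

lemma Cauchy_Schwarz_integral: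
  assumes f: "square_integrable M f" and g: "square_integrable M g"
  shows "(cmod (LINT x|M. f x * g x))\<^sup>2
    \<le> (LINT x|M. (cmod (f x))\<^sup>2) * (LINT x|M. (cmod (g x))\<^sup>2)"
proof -
  note cg = square_integrable_cnj[OF g]
  have "(cmod (LINT x|M. f x * cnj (cnj (g x))))\<^sup>2
      \<le> (LINT x|M. (cmod (f x))\<^sup>2) * (LINT x|M. (cmod (cnj (g x)))\<^sup>2)"
    by (rule Cauchy_Schwarz_discriminant;
        (unfold integral_norm_add_cmult_square[OF f cg, symmetric])?, intro integral_nonneg_AE) auto
  then show ?thesis by simp
qed

section \<open>The space of square integrable forms\<close>

text \<open>One operation yields sums (a = 1), differences (a = -1), midpoints and the complex
  perturbations in the projection argument, so that linearity and the norm expansion are proved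
  once.\<close>

definition form_lin :: "complex \<Rightarrow> 'n form \<Rightarrow> 'n form \<Rightarrow> 'n form" where
  "form_lin a f g = (\<lambda>z I J. f z I J + a * g z I J)"

lemma form_diff_eq_form_lin: "form_diff f g = form_lin (-1) f g"
  by (simp add: form_diff_def form_lin_def)

lemma L2_iff:
  "f \<in> L2 \<Omega> p q \<longleftrightarrow> (\<forall>z I J. \<not> (card I = p \<and> card J = q) \<longrightarrow> f z I J = 0) \<and>
     (\<forall>I J. square_integrable (lebesgue_on \<Omega>) (\<lambda>z. f z I J))"
  by (auto simp: L2_def square_integrable_def)

lemma L2_square_integrable:
  "f \<in> L2 \<Omega> p q \<Longrightarrow> square_integrable (lebesgue_on \<Omega>) (\<lambda>z. f z I J)"
  by (simp add: L2_iff)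

lemma form_lin_L2: "f \<in> L2 \<Omega> p q \<Longrightarrow> g \<in> L2 \<Omega> p q \<Longrightarrow> form_lin a f g \<in> L2 \<Omega> p q"
  by (auto simp: L2_iff form_lin_def intro!: square_integrable_add square_integrable_cmult)

lemma form_diff_L2: "f \<in> L2 \<Omega> p q \<Longrightarrow> g \<in> L2 \<Omega> p q \<Longrightarrow> form_diff f g \<in> L2 \<Omega> p q"
  by (simp add: form_diff_eq_form_lin form_lin_L2)

lemma integrable_L2_mult_cnj:
  "f \<in> L2 \<Omega> p q \<Longrightarrow> g \<in> L2 \<Omega> p q \<Longrightarrow>
    integrable (lebesgue_on \<Omega>) (\<lambda>z. f z I J * cnj (g z I J))"
  by (intro square_integrable_mult_integrable square_integrable_cnj L2_square_integrable)

lemma L2_inner_lin_left: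
  assumes "f \<in> L2 \<Omega> p q" "g \<in> L2 \<Omega> p q" "h \<in> L2 \<Omega> p q"
  shows "L2_inner \<Omega> p q (form_lin a f g) h = L2_inner \<Omega> p q f h + a * L2_inner \<Omega> p q g h"
proof -
  have "(LINT z|lebesgue_on \<Omega>. form_lin a f g z I J * cnj (h z I J))
     = (LINT z|lebesgue_on \<Omega>. f z I J * cnj (h z I J)) + a * (LINT z|lebesgue_on \<Omega>. g z I J * cnj (h z I J))"
    for I J
    using integrable_L2_mult_cnj[OF assms(1,3), of I J] integrable_L2_mult_cnj[OF assms(2,3), of I J]
    by (simp add: form_lin_def distrib_right mult.assoc)
  then show ?thesis
    by (simp add: L2_inner_def sum.distrib sum_distrib_left)
qed

lemma L2_inner_diff_left:
  assumes "f \<in> L2 \<Omega> p q" "g \<in> L2 \<Omega> p q" "h \<in> L2 \<Omega> p q"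
  shows "L2_inner \<Omega> p q (form_diff f g) h = L2_inner \<Omega> p q f h - L2_inner \<Omega> p q g h"
  using L2_inner_lin_left[OF assms, of "-1"] by (simp add: form_diff_eq_form_lin)

lemma L2_norm_square:
  "(L2_norm \<Omega> p q f)\<^sup>2 =
     (\<Sum>I | card I = p. \<Sum>J | card J = q. LINT z|lebesgue_on \<Omega>. (cmod (f z I J))\<^sup>2)"
  unfolding L2_norm_def by (intro real_sqrt_pow2 sum_nonneg integral_nonneg_AE) auto

lemma L2_norm_nonneg [simp]: "0 \<le> L2_norm \<Omega> p q f"
  unfolding L2_norm_def by (intro real_sqrt_ge_zero sum_nonneg integral_nonneg_AE) auto

lemma L2_inner_self: "L2_inner \<Omega> p q f f = of_real ((L2_norm \<Omega> p q f)\<^sup>2)"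
  unfolding L2_norm_square L2_inner_def of_real_sum
  by (intro sum.cong refl) (simp only: complex_norm_square flip: integral_complex_of_real)

lemma L2_norm_lin_square:
  assumes "f \<in> L2 \<Omega> p q" "g \<in> L2 \<Omega> p q"
  shows "(L2_norm \<Omega> p q (form_lin a f g))\<^sup>2 = (L2_norm \<Omega> p q f)\<^sup>2
    + 2 * Re (cnj a * L2_inner \<Omega> p q f g) + (cmod a)\<^sup>2 * (L2_norm \<Omega> p q g)\<^sup>2"
  unfolding L2_norm_square L2_inner_def form_lin_def
  by (simp only: integral_norm_add_cmult_square[OF L2_square_integrable[OF assms(1)]
      L2_square_integrable[OF assms(2)]] sum.distrib sum_distrib_left Re_sum)

lemma L2_Cauchy_Schwarz:
  assumes "f \<in> L2 \<Omega> p q" "g \<in> L2 \<Omega> p q"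
  shows "cmod (L2_inner \<Omega> p q f g) \<le> L2_norm \<Omega> p q f * L2_norm \<Omega> p q g"
proof -
  have "(cmod (L2_inner \<Omega> p q f g))\<^sup>2 \<le> (L2_norm \<Omega> p q f)\<^sup>2 * (L2_norm \<Omega> p q g)\<^sup>2"
    by (rule Cauchy_Schwarz_discriminant) (simp_all only: L2_norm_lin_square[OF assms, symmetric] zero_le_power2)
  then show ?thesis
    by - (rule power2_le_imp_le, simp_all add: power_mult_distrib)
qed

lemma L2_norm_lin_one_le:
  assumes "f \<in> L2 \<Omega> p q" "g \<in> L2 \<Omega> p q"
  shows "L2_norm \<Omega> p q (form_lin 1 f g) \<le> L2_norm \<Omega> p q f + L2_norm \<Omega> p q g"
proof (rule power2_le_imp_le)
  have "Re (L2_inner \<Omega> p q f g) \<le> L2_norm \<Omega> p q f * L2_norm \<Omega> p q g"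
    using L2_Cauchy_Schwarz[OF assms] complex_Re_le_cmod order_trans by blast
  then show "(L2_norm \<Omega> p q (form_lin 1 f g))\<^sup>2 \<le> (L2_norm \<Omega> p q f + L2_norm \<Omega> p q g)\<^sup>2"
    unfolding L2_norm_lin_square[OF assms] by (simp add: power2_sum)
qed simp

lemma L2_norm_scale: "L2_norm \<Omega> p q (mult_op (\<lambda>_. c) f) = cmod c * L2_norm \<Omega> p q f"
proof -
  have "(L2_norm \<Omega> p q (mult_op (\<lambda>_. c) f))\<^sup>2 = (cmod c * L2_norm \<Omega> p q f)\<^sup>2"
    by (simp add: L2_norm_square mult_op_def norm_mult power_mult_distrib sum_distrib_left)
  then show ?thesis by (simp add: power2_eq_iff_nonneg)
qed

lemma L2_parallelogram:
  assumes "f \<in> L2 \<Omega> p q" "g \<in> L2 \<Omega> p q"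
  shows "(L2_norm \<Omega> p q (form_lin 1 f g))\<^sup>2 + (L2_norm \<Omega> p q (form_lin (-1) f g))\<^sup>2
    = 2 * (L2_norm \<Omega> p q f)\<^sup>2 + 2 * (L2_norm \<Omega> p q g)\<^sup>2"
  by (simp add: L2_norm_lin_square[OF assms])

text \<open>A single coefficient is one of the nonnegative summands of the squared norm; in other
  degrees it vanishes identically, so I and J are unrestricted. This lets limits be taken
  coefficient by coefficient.\<close>

lemma L2_coefficient_le_norm:
  assumes "f \<in> L2 \<Omega> p q"
  shows "(LINT z|lebesgue_on \<Omega>. (cmod (f z I J))\<^sup>2) \<le> (L2_norm \<Omega> p q f)\<^sup>2"
proof (cases "card I = p \<and> card J = q")
  case True
  let ?c = "\<lambda>I J. LINT z|lebesgue_on \<Omega>. (cmod (f z I J))\<^sup>2"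
  have nn: "0 \<le> ?c I J" for I J by (intro integral_nonneg_AE) auto
  have "?c I J \<le> (\<Sum>J | card J = q. ?c I J)"
    using True by (intro member_le_sum nn) auto
  also have "\<dots> \<le> (\<Sum>I | card I = p. \<Sum>J | card J = q. ?c I J)"
    using True by (intro member_le_sum[where f="\<lambda>I. \<Sum>J | card J = q. ?c I J"] sum_nonneg nn) auto
  finally show ?thesis by (simp add: L2_norm_square)
next
  case False
  then show ?thesis using assms by (simp add: L2_iff)
qed

lemma L2_complete:
  assumes \<Omega>: "finite_measure (lebesgue_on \<Omega>)" and F: "\<And>j. F j \<in> L2 \<Omega> p q"
    and Cauchy: "\<And>e. e > 0 \<Longrightarrow> \<exists>N. \<forall>m\<ge>N. \<forall>n\<ge>N. (L2_norm \<Omega> p q (form_diff (F m) (F n)))\<^sup>2 < e"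
  obtains g where "g \<in> L2 \<Omega> p q" "(\<lambda>j. L2_norm \<Omega> p q (form_diff (F j) g)) \<longlonglongrightarrow> 0"
proof -
  have ex: "\<exists>h. square_integrable (lebesgue_on \<Omega>) h \<and>
      (\<lambda>j. LINT z|lebesgue_on \<Omega>. (cmod (F j z I J - h z))\<^sup>2) \<longlonglongrightarrow> 0" for I J
  proof -
    have le: "(LINT z|lebesgue_on \<Omega>. (cmod (F m z I J - F n z I J))\<^sup>2)
        \<le> (L2_norm \<Omega> p q (form_diff (F m) (F n)))\<^sup>2" for m n
      using L2_coefficient_le_norm[OF form_diff_L2[OF F F]] by (simp add: form_diff_def)
    have "\<exists>N. \<forall>m\<ge>N. \<forall>n\<ge>N. (LINT z|lebesgue_on \<Omega>. (cmod (F m z I J - F n z I J))\<^sup>2) < e"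
      if "e > 0" for e
      using Cauchy[OF that] le by (meson le_less_trans)
    from square_integrable_complete[OF \<Omega> L2_square_integrable[OF F] this] show ?thesis by blast
  qed
  obtain h where h: "\<And>I J. square_integrable (lebesgue_on \<Omega>) (h I J)"
      "\<And>I J. (\<lambda>j. LINT z|lebesgue_on \<Omega>. (cmod (F j z I J - h I J z))\<^sup>2) \<longlonglongrightarrow> 0"
    using that[of "\<lambda>I J. SOME h. square_integrable (lebesgue_on \<Omega>) h \<and>
      (\<lambda>j. LINT z|lebesgue_on \<Omega>. (cmod (F j z I J - h z))\<^sup>2) \<longlonglongrightarrow> 0"] ex[THEN someI_ex]
    by blast
  \<comment> \<open>Membership in \<open>L2\<close> demands exact, not almost everywhere, vanishing
    in the wrong degrees, which the coefficientwise limits h do not guarantee.\<close>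
  define g where "g z I J = (if card I = p \<and> card J = q then h I J z else 0)" for z I J
  have g: "g \<in> L2 \<Omega> p q"
    unfolding L2_iff
  proof (intro conjI allI impI)
    show "square_integrable (lebesgue_on \<Omega>) (\<lambda>z. g z I J)" for I J
      using h(1)[of I J] by (cases "card I = p \<and> card J = q") (auto simp: g_def)
  qed (auto simp: g_def)
  have "(\<lambda>j. \<Sum>I | card I = p. \<Sum>J | card J = q. LINT z|lebesgue_on \<Omega>. (cmod (form_diff (F j) g z I J))\<^sup>2)
      \<longlonglongrightarrow> (\<Sum>I::'a set | card I = p. \<Sum>J::'a set | card J = q. 0)"
    using h(2) by (intro tendsto_sum) (simp add: form_diff_def g_def)
  then have "(\<lambda>j. L2_norm \<Omega> p q (form_diff (F j) g)) \<longlonglongrightarrow> sqrt 0"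
    unfolding L2_norm_def by (intro tendsto_real_sqrt) simp
  with g show thesis using that by simp
qed

section \<open>Closed forms and the orthogonal projection\<close>

lemma finite_measure_lebesgue_on_bounded:
  fixes \<Omega> :: "'a::euclidean_space set"
  assumes "bounded \<Omega>" "open \<Omega>"
  shows "finite_measure (lebesgue_on \<Omega>)"
  using assms by (intro finite_measure_lebesgue_on bounded_set_imp_lmeasurable) auto

text \<open>Continuity on the whole space, not just on \<Omega>, gives boundedness on the compact
  closure.\<close>

lemma square_integrable_continuous:
  fixes \<Omega> :: "'a::euclidean_space set"
  assumes bd: "bounded \<Omega>" and op: "open \<Omega>" and g: "continuous_on UNIV g"
  shows "square_integrable (lebesgue_on \<Omega>) g"
proof -
  interpret finite_measure "lebesgue_on \<Omega>"
    by (rule finite_measure_lebesgue_on_bounded[OF bd op])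
  have "compact (g ` closure \<Omega>)"
    using bd g by (intro compact_continuous_image) (auto intro: continuous_on_subset)
  then obtain C where C: "\<And>z. z \<in> closure \<Omega> \<Longrightarrow> cmod (g z) \<le> C"
    using compact_imp_bounded bounded_iff by (metis imageI)
  have "square_integrable (lebesgue_on \<Omega>) (\<lambda>z. g z * 1)"
  proof (rule square_integrable_bounded_mult)
    show "square_integrable (lebesgue_on \<Omega>) (\<lambda>z. 1)" by (simp add: square_integrable_def)
    show "g \<in> borel_measurable (lebesgue_on \<Omega>)"
      using g op by (intro continuous_imp_measurable_on_sets_lebesgue)
        (auto intro: continuous_on_subset)
    show "AE z in lebesgue_on \<Omega>. cmod (g z) \<le> C"
      using C closure_subset by (intro AE_I2) (auto simp: subset_iff)
  qed
  then show ?thesis by simp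
qed

lemma test_function_derivative_continuous:
  "test_function \<Omega> \<psi> \<Longrightarrow> continuous_on UNIV (\<lambda>z. frechet_derivative \<psi> (at z) v)"
  unfolding test_function_def by (auto dest!: spec[of _ "Suc 0"])

lemma d_zbar_square_integrable:
  assumes "bounded \<Omega>" "open \<Omega>" "test_function U \<psi>"
  shows "square_integrable (lebesgue_on \<Omega>) (d_zbar k \<psi>)"
proof (rule square_integrable_continuous[OF assms(1,2)])
  show "continuous_on UNIV (d_zbar k \<psi>)"
    unfolding d_zbar_def
    by (intro continuous_intros test_function_derivative_continuous[OF assms(3)]) auto
qed

lemma K2_imp_L2: "f \<in> K2 \<Omega> p q \<Longrightarrow> f \<in> L2 \<Omega> p q"
  by (simp add: K2_def)

lemma zero_form_K2: "(\<lambda>z I J. 0) \<in> K2 \<Omega> p q"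
  by (simp add: K2_def L2_iff dbar_dist_def)

lemma dbar_dist_lin:
  assumes "bounded \<Omega>" "open \<Omega>" "test_function \<Omega> \<psi>" and f: "f \<in> L2 \<Omega> p q" and g: "g \<in> L2 \<Omega> p q"
  shows "dbar_dist \<Omega> p (form_lin a f g) I K \<psi>
    = dbar_dist \<Omega> p f I K \<psi> + a * dbar_dist \<Omega> p g I K \<psi>"
proof -
  note int = square_integrable_mult_integrable[OF L2_square_integrable d_zbar_square_integrable[OF assms(1-3)]]
  have "(LINT z|lebesgue_on \<Omega>. form_lin a f g z I J * d_zbar k \<psi> z)
      = (LINT z|lebesgue_on \<Omega>. f z I J * d_zbar k \<psi> z) + a * (LINT z|lebesgue_on \<Omega>. g z I J * d_zbar k \<psi> z)"
    for J k
    using int[OF f, of I J k] int[OF g, of I J k] by (simp add: form_lin_def distrib_right mult.assoc)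
  then show ?thesis
    unfolding dbar_dist_def sum_distrib_left sum.distrib[symmetric]
    by (intro sum.cong refl) (simp add: algebra_simps)
qed

lemma K2_form_lin:
  assumes "bounded \<Omega>" "open \<Omega>" "f \<in> K2 \<Omega> p q" "g \<in> K2 \<Omega> p q"
  shows "form_lin a f g \<in> K2 \<Omega> p q"
  using assms dbar_dist_lin[OF assms(1,2)] by (auto simp: K2_def form_lin_L2)

text \<open>Being closed is a family of conditions on integrals against the square integrable
  functions \<open>d_zbar k \<psi>\<close>; by Cauchy-Schwarz each is continuous in the
  norm.\<close>

lemma K2_closed:
  fixes \<Omega> :: "('n::{finite,linorder}) cspace set"
  assumes bd: "bounded \<Omega>" and op: "open \<Omega>" and F: "\<And>j. F j \<in> K2 \<Omega> p q" and g: "g \<in> L2 \<Omega> p q"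
    and lim: "(\<lambda>j. L2_norm \<Omega> p q (form_diff (F j) g)) \<longlonglongrightarrow> 0"
  shows "g \<in> K2 \<Omega> p q"
  unfolding K2_def
proof (intro CollectI conjI allI impI g)
  fix I K :: "'n set" and \<psi> assume card: "card I = p" "card K = q + 1" and \<psi>: "test_function \<Omega> \<psi>"
  have FL: "F j \<in> L2 \<Omega> p q" for j using F by (rule K2_imp_L2)
  note sd = d_zbar_square_integrable[OF bd op \<psi>]
  have "(\<lambda>j. LINT z|lebesgue_on \<Omega>. form_diff (F j) g z I J * d_zbar k \<psi> z) \<longlonglongrightarrow> 0" for J k
  proof (rule Lim_null_comparison)
    let ?B = "sqrt (LINT z|lebesgue_on \<Omega>. (cmod (d_zbar k \<psi> z))\<^sup>2)"
    have B: "0 \<le> (LINT z|lebesgue_on \<Omega>. (cmod (d_zbar k \<psi> z))\<^sup>2)" by (intro integral_nonneg_AE) auto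
    show "\<forall>\<^sub>F j in sequentially. cmod (LINT z|lebesgue_on \<Omega>. form_diff (F j) g z I J * d_zbar k \<psi> z)
        \<le> L2_norm \<Omega> p q (form_diff (F j) g) * ?B"
    proof (intro always_eventually allI)
      fix j
      have D: "form_diff (F j) g \<in> L2 \<Omega> p q" by (intro form_diff_L2 FL g)
      have "(cmod (LINT z|lebesgue_on \<Omega>. form_diff (F j) g z I J * d_zbar k \<psi> z))\<^sup>2
          \<le> (LINT z|lebesgue_on \<Omega>. (cmod (form_diff (F j) g z I J))\<^sup>2)
            * (LINT z|lebesgue_on \<Omega>. (cmod (d_zbar k \<psi> z))\<^sup>2)"
        by (rule Cauchy_Schwarz_integral[OF L2_square_integrable[OF D] sd])
      also have "\<dots> \<le> (L2_norm \<Omega> p q (form_diff (F j) g))\<^sup>2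
            * (LINT z|lebesgue_on \<Omega>. (cmod (d_zbar k \<psi> z))\<^sup>2)"
        by (intro mult_right_mono L2_coefficient_le_norm D B)
      also have "\<dots> = (L2_norm \<Omega> p q (form_diff (F j) g) * ?B)\<^sup>2"
        using B by (simp add: power_mult_distrib)
      finally show "cmod (LINT z|lebesgue_on \<Omega>. form_diff (F j) g z I J * d_zbar k \<psi> z)
          \<le> L2_norm \<Omega> p q (form_diff (F j) g) * ?B"
        using B by - (rule power2_le_imp_le, simp_all)
    qed
    show "(\<lambda>j. L2_norm \<Omega> p q (form_diff (F j) g) * ?B) \<longlonglongrightarrow> 0"
      using tendsto_mult_right[OF lim, of ?B] by simp
  qed
  then have "(\<lambda>j. dbar_dist \<Omega> p (form_diff (F j) g) I K \<psi>)
      \<longlonglongrightarrow> (-1)^p * (\<Sum>k\<in>K. (-1) ^ card {j \<in> K. j < k} * (- 0))"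
    unfolding dbar_dist_def by (intro tendsto_intros) auto
  \<comment> \<open>The F j contribute nothing, so the sequence tending to 0 is constant.\<close>
  moreover have "dbar_dist \<Omega> p (form_diff (F j) g) I K \<psi> = - dbar_dist \<Omega> p g I K \<psi>" for j
    using dbar_dist_lin[OF bd op \<psi> FL[of j] g, of "-1" I K] F[of j] card \<psi>
    by (simp add: form_diff_eq_form_lin K2_def)
  ultimately have "(\<lambda>j::nat. - dbar_dist \<Omega> p g I K \<psi>) \<longlonglongrightarrow> 0" by simp
  then show "dbar_dist \<Omega> p g I K \<psi> = 0" by (simp add: LIMSEQ_const_iff)
qed

text \<open>The classical argument: a minimizing sequence for the distance from f to the closed
  subspace is Cauchy by the parallelogram law, and its limit is the projection.\<close>

lemma K2_projection_exists:
  assumes bd: "bounded \<Omega>" and op: "open \<Omega>" and f: "f \<in> L2 \<Omega> p q"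
  shows "\<exists>g \<in> K2 \<Omega> p q. \<forall>h \<in> K2 \<Omega> p q. L2_inner \<Omega> p q (form_diff f g) h = 0"
proof -
  let ?n = "\<lambda>g. (L2_norm \<Omega> p q g)\<^sup>2"
  define d where "d = (INF g\<in>K2 \<Omega> p q. ?n (form_diff f g))"
  have bdd: "bdd_below ((\<lambda>g. ?n (form_diff f g)) ` K2 \<Omega> p q)"
    by (intro bdd_belowI2[of _ 0]) simp
  have d_le: "d \<le> ?n (form_diff f g)" if "g \<in> K2 \<Omega> p q" for g
    unfolding d_def by (rule cINF_lower[OF bdd that])
  have d_nonneg: "0 \<le> d"
    unfolding d_def using zero_form_K2 by (intro cINF_greatest) auto
  have "\<exists>g\<in>K2 \<Omega> p q. ?n (form_diff f g) < d + 1 / real (Suc n)" for n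
  proof -
    have "Inf ((\<lambda>g. ?n (form_diff f g)) ` K2 \<Omega> p q) < d + 1 / real (Suc n)"
      by (simp add: d_def)
    then show ?thesis
      using zero_form_K2 by (subst (asm) cInf_less_iff[OF _ bdd]) auto
  qed
  then obtain G where G: "\<And>n. G n \<in> K2 \<Omega> p q"
      and Gd: "\<And>n. ?n (form_diff f (G n)) < d + 1 / real (Suc n)"
    by metis
  have GL: "G n \<in> L2 \<Omega> p q" for n using G by (rule K2_imp_L2)
  have Cauchy_bound: "?n (form_diff (G m) (G n)) \<le> 2 / real (Suc m) + 2 / real (Suc n)" for m n
  proof -
    \<comment> \<open>The midpoint of G m and G n. Its squared distance from f is at least d, so the
      parallelogram law leaves only the excesses of G m and G n over d, each counted twice.\<close>
    define mid where "mid = form_lin (1/2) (G n) (form_lin (-1) (G m) (G n))"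
    have mid: "mid \<in> K2 \<Omega> p q" unfolding mid_def by (intro K2_form_lin bd op G)
    have "form_lin 1 (form_diff f (G n)) (form_diff f (G m)) = mult_op (\<lambda>_. 2) (form_diff f mid)"
      by (intro ext) (simp add: form_lin_def form_diff_def mult_op_def mid_def algebra_simps)
    then have plus: "?n (form_lin 1 (form_diff f (G n)) (form_diff f (G m))) = 4 * ?n (form_diff f mid)"
      by (simp add: L2_norm_scale power_mult_distrib)
    have minus: "form_lin (-1) (form_diff f (G n)) (form_diff f (G m)) = form_diff (G m) (G n)"
      by (intro ext) (simp add: form_lin_def form_diff_def)
    show ?thesis
      using L2_parallelogram[OF form_diff_L2[OF f GL[of n]] form_diff_L2[OF f GL[of m]]]
        d_le[OF mid] Gd[of m] Gd[of n]
      unfolding plus minus by simp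
  qed
  have "\<exists>N. \<forall>m\<ge>N. \<forall>n\<ge>N. ?n (form_diff (G m) (G n)) < e" if e: "e > 0" for e
  proof -
    obtain N where N: "1 / real (Suc N) < e / 4"
      using reals_Archimedean[of "e / 4"] e by (auto simp: inverse_eq_divide)
    have "?n (form_diff (G m) (G n)) < e" if "m \<ge> N" "n \<ge> N" for m n
    proof -
      have "1 / real (Suc m) \<le> 1 / real (Suc N)" "1 / real (Suc n) \<le> 1 / real (Suc N)"
        using that by (auto intro!: divide_left_mono)
      then show ?thesis using Cauchy_bound[of m n] N by simp
    qed
    then show ?thesis by blast
  qed
  from L2_complete[OF finite_measure_lebesgue_on_bounded[OF bd op] GL this]
  obtain g where gL: "g \<in> L2 \<Omega> p q" and lim: "(\<lambda>j. L2_norm \<Omega> p q (form_diff (G j) g)) \<longlonglongrightarrow> 0"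
    by blast
  have g: "g \<in> K2 \<Omega> p q" by (rule K2_closed[OF bd op G gL lim])
  have "L2_norm \<Omega> p q (form_diff f g) \<le> sqrt (d + 0) + 0"
  proof (rule tendsto_lowerbound)
    show "(\<lambda>j. sqrt (d + 1 / real (Suc j)) + L2_norm \<Omega> p q (form_diff (G j) g)) \<longlonglongrightarrow> sqrt (d + 0) + 0"
      by (intro tendsto_intros lim LIMSEQ_Suc lim_1_over_n)
    show "\<forall>\<^sub>F j in sequentially. L2_norm \<Omega> p q (form_diff f g)
        \<le> sqrt (d + 1 / real (Suc j)) + L2_norm \<Omega> p q (form_diff (G j) g)"
    proof (intro always_eventually allI)
      fix j
      have "form_diff f g = form_lin 1 (form_diff f (G j)) (form_diff (G j) g)"
        by (intro ext) (simp add: form_lin_def form_diff_def)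
      then have "L2_norm \<Omega> p q (form_diff f g)
          \<le> L2_norm \<Omega> p q (form_diff f (G j)) + L2_norm \<Omega> p q (form_diff (G j) g)"
        using L2_norm_lin_one_le[OF form_diff_L2[OF f GL] form_diff_L2[OF GL gL]] by simp
      moreover have "L2_norm \<Omega> p q (form_diff f (G j)) \<le> sqrt (d + 1 / real (Suc j))"
        using Gd[of j] by (intro real_le_rsqrt) simp
      ultimately show "L2_norm \<Omega> p q (form_diff f g)
          \<le> sqrt (d + 1 / real (Suc j)) + L2_norm \<Omega> p q (form_diff (G j) g)" by simp
    qed
  qed simp
  then have gd: "?n (form_diff f g) \<le> d"
    using d_nonneg power_mono[of "L2_norm \<Omega> p q (form_diff f g)" "sqrt d" 2] by simp
  have "L2_inner \<Omega> p q (form_diff f g) h = 0" if h: "h \<in> K2 \<Omega> p q" for h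
  proof -
    have hL: "h \<in> L2 \<Omega> p q" using h by (rule K2_imp_L2)
    \<comment> \<open>Moving g by multiples of h does not decrease the distance to f. Once the
      minimum is subtracted, the quadratic expression has A = 0, and the discriminant bound
      annihilates the inner product.\<close>
    have "(cmod (L2_inner \<Omega> p q (form_diff f g) h))\<^sup>2 \<le> 0 * ?n h"
    proof (rule Cauchy_Schwarz_discriminant)
      fix a
      have "form_lin a (form_diff f g) h = form_diff f (form_lin (-a) g h)"
        by (intro ext) (simp add: form_lin_def form_diff_def)
      then have "?n (form_diff f g) \<le> ?n (form_lin a (form_diff f g) h)"
        using d_le[OF K2_form_lin[OF bd op g h]] gd by (metis order_trans)
      then show "0 \<le> 0 + 2 * Re (cnj a * L2_inner \<Omega> p q (form_diff f g) h) + (cmod a)\<^sup>2 * ?n h"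
        unfolding L2_norm_lin_square[OF form_diff_L2[OF f gL] hL] by simp
    qed simp
    then show ?thesis by simp
  qed
  with g show ?thesis by blast
qed

lemma proj_K2:
  assumes "bounded \<Omega>" "open \<Omega>" "f \<in> L2 \<Omega> p q"
  shows "proj_K2 \<Omega> p q f \<in> K2 \<Omega> p q"
    and "h \<in> K2 \<Omega> p q \<Longrightarrow> L2_inner \<Omega> p q (proj_K2 \<Omega> p q f) h = L2_inner \<Omega> p q f h"
proof -
  let ?P = "\<lambda>g. g \<in> K2 \<Omega> p q \<and> (\<forall>h \<in> K2 \<Omega> p q. L2_inner \<Omega> p q (form_diff f g) h = 0)"
  have *: "?P (proj_K2 \<Omega> p q f)"
    unfolding proj_K2_def using K2_projection_exists[OF assms] by (intro someI_ex[of ?P]) blast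
  then show "proj_K2 \<Omega> p q f \<in> K2 \<Omega> p q" by simp
  show "L2_inner \<Omega> p q (proj_K2 \<Omega> p q f) h = L2_inner \<Omega> p q f h" if "h \<in> K2 \<Omega> p q"
    using * that assms(3) L2_inner_diff_left[of f \<Omega> p q "proj_K2 \<Omega> p q f" h]
    by (simp add: K2_imp_L2)
qed

section \<open>Compactly supported closed forms\<close>

lemma integral_lborel_translate:
  fixes h :: "'a::euclidean_space \<Rightarrow> 'b::{banach, second_countable_topology}"
  assumes "h \<in> borel_measurable borel"
  shows "(LINT z|lborel. h (t + z)) = (LINT z|lborel. h z)"
  using integral_distr[of "(+) t" lborel borel h] assms by (simp add: lborel_distr_plus)

lemma integrable_continuous_compact_support:
  fixes h :: "'a::euclidean_space \<Rightarrow> 'b::{banach, second_countable_topology}"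
  assumes "continuous_on UNIV h" and "\<And>z. z \<notin> cball c R \<Longrightarrow> h z = 0"
  shows "integrable lborel h"
proof -
  have "integrable lborel (\<lambda>z. indicator (cball c R) z *\<^sub>R h z)"
    using assms(1) by (intro borel_integrable_compact) (auto intro: continuous_on_subset)
  moreover have "(\<lambda>z. indicator (cball c R) z *\<^sub>R h z) = h"
    using assms(2) by (auto simp: indicator_def)
  ultimately show ?thesis by simp
qed

section \<open>Difference quotients and integration by parts for C1 functions\<close>

lemma C_k_1_D:
  assumes "C_k 1 f"
  shows "f differentiable (at z)" "continuous_on UNIV (\<lambda>z. frechet_derivative f (at z) v)"
    and "continuous_on UNIV f"
  using assms by (auto intro: differentiable_imp_continuous_on simp: differentiable_on_def
      differentiable_at_withinI)

lemma C_k_1_line_derivative: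
  assumes "C_k 1 f"
  shows "((\<lambda>t. f (z + t *\<^sub>R v)) has_vector_derivative frechet_derivative f (at (z + t *\<^sub>R v)) v)
    (at t within S)"
proof -
  let ?D = "frechet_derivative f (at (z + t *\<^sub>R v))"
  have "(f has_derivative ?D) (at (z + t *\<^sub>R v))"
    using C_k_1_D(1)[OF assms] by (simp add: frechet_derivative_works)
  moreover have "((\<lambda>t. z + t *\<^sub>R v) has_derivative (\<lambda>h. h *\<^sub>R v)) (at t within S)"
    by (auto intro!: derivative_eq_intros)
  ultimately have "((\<lambda>t. f (z + t *\<^sub>R v)) has_derivative (\<lambda>h. ?D (h *\<^sub>R v))) (at t within S)"
    by (intro has_derivative_compose[where g=f and f="\<lambda>t. z + t *\<^sub>R v"])
  moreover have "?D (h *\<^sub>R v) = h *\<^sub>R ?D v" for h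
    using C_k_1_D(1)[OF assms] by (simp add: linear_frechet_derivative linear_cmul)
  ultimately show ?thesis by (simp add: has_vector_derivative_def)
qed

text \<open>The steps form a fixed sequence, since the limit is later taken under the integral by
  dominated convergence.\<close>

lemma C_k_1_difference_quotient_tendsto:
  assumes "C_k 1 f"
  shows "(\<lambda>n. (f (z + inverse (real (Suc n)) *\<^sub>R v) - f z) /\<^sub>R inverse (real (Suc n)))
    \<longlonglongrightarrow> frechet_derivative f (at z) v"
proof -
  have "((\<lambda>t. (f (z + t *\<^sub>R v) - f z) /\<^sub>R t) \<longlongrightarrow> frechet_derivative f (at z) v) (at 0)"
  proof (rule Lim_null[THEN iffD2], rule Lim_null_comparison)
    let ?D = "frechet_derivative f (at z) v"
    have "((\<lambda>t. (1 / norm (t - 0)) *\<^sub>R (f (z + t *\<^sub>R v) - (f (z + 0 *\<^sub>R v) + (t - 0) *\<^sub>R ?D))) \<longlongrightarrow> 0) (at 0)"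
      using C_k_1_line_derivative[OF assms, of z v 0 UNIV]
      unfolding has_vector_derivative_def has_derivative_at2 by simp
    from tendsto_norm_zero[OF this]
    show "((\<lambda>t. norm ((1 / norm t) *\<^sub>R (f (z + t *\<^sub>R v) - (f z + t *\<^sub>R ?D)))) \<longlongrightarrow> 0) (at 0)"
      by simp
    have "norm ((f (z + t *\<^sub>R v) - f z) /\<^sub>R t - ?D)
        \<le> norm ((1 / norm t) *\<^sub>R (f (z + t *\<^sub>R v) - (f z + t *\<^sub>R ?D)))" if "t \<noteq> 0" for t
    proof -
      have "(f (z + t *\<^sub>R v) - f z) /\<^sub>R t - ?D = (f (z + t *\<^sub>R v) - (f z + t *\<^sub>R ?D)) /\<^sub>R t"
        using that by (simp add: algebra_simps)
      then show ?thesis by (simp add: divide_inverse)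
    qed
    then show "\<forall>\<^sub>F t in at 0. norm ((f (z + t *\<^sub>R v) - f z) /\<^sub>R t - ?D)
        \<le> norm ((1 / norm t) *\<^sub>R (f (z + t *\<^sub>R v) - (f z + t *\<^sub>R ?D)))"
      by (auto simp: eventually_at_filter)
  qed
  moreover have "filterlim (\<lambda>n. inverse (real (Suc n))) (at 0) sequentially"
    unfolding filterlim_at using LIMSEQ_inverse_real_of_nat by simp
  ultimately show ?thesis by (rule filterlim_compose)
qed

text \<open>Mean value inequality: with steps at most 1, every segment stays in the ball of radius
  \<open>R + norm v\<close>, where the directional derivative is bounded by compactness. This
  supplies the dominating constant.\<close>

lemma C_k_1_difference_quotient_bounded:
  fixes f :: "'a::euclidean_space \<Rightarrow> 'b::real_normed_vector"
  assumes "C_k 1 f"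
  obtains B where "0 \<le> B" "\<And>z s. z \<in> cball c R \<Longrightarrow> 0 < s \<Longrightarrow> s \<le> 1 \<Longrightarrow>
    norm ((f (z + s *\<^sub>R v) - f z) /\<^sub>R s) \<le> B"
proof -
  have "compact ((\<lambda>z. frechet_derivative f (at z) v) ` cball c (R + norm v))"
    using C_k_1_D(2)[OF assms] by (intro compact_continuous_image) (auto intro: continuous_on_subset)
  from compact_imp_bounded[OF this]
  obtain B where B: "\<And>z. z \<in> cball c (R + norm v) \<Longrightarrow> norm (frechet_derivative f (at z) v) \<le> B"
    unfolding bounded_iff by blast
  have "norm ((f (z + s *\<^sub>R v) - f z) /\<^sub>R s) \<le> max 0 B"
    if z: "z \<in> cball c R" and s: "0 < s" "s \<le> 1" for z s
  proof -
    have "norm (f (z + s *\<^sub>R v) - f (z + 0 *\<^sub>R v)) \<le> max 0 B * norm (s - 0)"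
    proof (rule differentiable_bound[where S="{0..s}" and f="\<lambda>t. f (z + t *\<^sub>R v)"])
      fix t assume t: "t \<in> {0..s}"
      show "((\<lambda>t. f (z + t *\<^sub>R v)) has_derivative
          (\<lambda>h. h *\<^sub>R frechet_derivative f (at (z + t *\<^sub>R v)) v)) (at t within {0..s})"
        using C_k_1_line_derivative[OF assms] by (simp add: has_vector_derivative_def)
      have "norm (t *\<^sub>R v) \<le> norm v" using t s by (simp add: mult_left_le_one_le)
      then have "z + t *\<^sub>R v \<in> cball c (R + norm v)"
        using z norm_triangle_ineq[of "z - c" "t *\<^sub>R v"]
        by (simp add: dist_norm norm_minus_commute add_diff_eq diff_add_eq)
      then have "norm (frechet_derivative f (at (z + t *\<^sub>R v)) v) \<le> max 0 B"
        using B by (meson max.coboundedI2)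
      then show "onorm (\<lambda>h. h *\<^sub>R frechet_derivative f (at (z + t *\<^sub>R v)) v) \<le> max 0 B"
        by (intro onorm_le) (simp only: norm_scaleR real_norm_def mult.commute[of "max 0 B"] mult_left_mono abs_ge_zero)
    qed (use s in auto)
    then show ?thesis using s by (simp add: divide_simps mult.commute)
  qed
  then show thesis using that[of "max 0 B"] by auto
qed

text \<open>
  The integration by parts behind \<open>\<integral> \<partial>\<^sub>v \<eta> \<partial>\<^sub>w \<psi> = \<integral> \<partial>\<^sub>w \<eta> \<partial>\<^sub>v \<psi>\<close>, done on difference
  quotients: translation invariance makes the quotient version exactly symmetric, so that no second derivatives occur.
\<close>

lemma integral_difference_product_commute:
  fixes \<eta> \<psi> :: "'a::euclidean_space \<Rightarrow> complex"
  assumes \<eta>: "continuous_on UNIV \<eta>" and \<psi>: "continuous_on UNIV \<psi>"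
    and supp: "\<And>z. z \<notin> cball c r \<Longrightarrow> \<eta> z = 0"
  shows "(LINT z|lborel. (\<eta> (z + v) - \<eta> z) * (\<psi> (z - w) - \<psi> z))
    = (LINT z|lborel. (\<eta> (z + w) - \<eta> z) * (\<psi> (z - v) - \<psi> z))"
proof -
  have c\<eta>: "continuous_on UNIV (\<lambda>z. \<eta> (z + u))" for u
    by (intro continuous_on_compose2[OF \<eta>] continuous_intros) auto
  have c\<psi>: "continuous_on UNIV (\<lambda>z. \<psi> (z - u))" for u
    by (intro continuous_on_compose2[OF \<psi>] continuous_intros) auto
  have int: "integrable lborel (\<lambda>z. \<eta> (z + u) * \<psi> (z - t))" for u t
  proof (rule integrable_continuous_compact_support[where c="c - u"])
    show "continuous_on UNIV (\<lambda>z. \<eta> (z + u) * \<psi> (z - t))"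
      by (intro continuous_intros c\<eta> c\<psi>)
    show "\<eta> (z + u) * \<psi> (z - t) = 0" if "z \<notin> cball (c - u) r" for z
      using that supp[of "z + u"] by (auto simp: dist_norm algebra_simps)
  qed
  define H where "H u = (LINT z|lborel. \<eta> (z + u) * \<psi> z)" for u
  have shift: "(LINT z|lborel. \<eta> (z + u) * \<psi> (z - t)) = H (u + t)" for u t
  proof -
    have "(LINT z|lborel. \<eta> (t + z + u) * \<psi> (t + z - t)) = (LINT z|lborel. \<eta> (z + u) * \<psi> (z - t))"
      by (rule integral_lborel_translate[where h="\<lambda>z. \<eta> (z + u) * \<psi> (z - t)"])
        (intro borel_measurable_continuous_onI continuous_intros c\<eta> c\<psi>)
    then show ?thesis by (simp add: H_def add_ac)
  qed
  \<comment> \<open>Expanding the product and translating each term leaves an expression in H that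
    is visibly symmetric in v and w.\<close>
  have "(LINT z|lborel. (\<eta> (z + v) - \<eta> z) * (\<psi> (z - w) - \<psi> z)) = H (v + w) - H v - H w + H 0" for v w
  proof -
    have "(\<eta> (z + v) - \<eta> z) * (\<psi> (z - w) - \<psi> z)
        = \<eta> (z + v) * \<psi> (z - w) - \<eta> (z + v) * \<psi> (z - 0) - \<eta> (z + 0) * \<psi> (z - w) + \<eta> (z + 0) * \<psi> (z - 0)" for z
      by (simp add: algebra_simps)
    then show ?thesis
      by (simp only: Bochner_Integration.integral_add Bochner_Integration.integral_diff
          Bochner_Integration.integrable_diff int shift) simp
  qed
  from this[of v w] this[of w v] show ?thesis by (simp add: add.commute[of w v])
qed

text \<open>The symmetric identity for quotients passes to the limit by dominated convergence. The
  quotients of \<psi> use backward steps, so the limits carry -w and -v; the two signs agree and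
  drop out.\<close>

lemma integral_directional_derivatives_commute:
  fixes \<eta> \<psi> :: "'a::euclidean_space \<Rightarrow> complex"
  assumes \<eta>: "C_k 1 \<eta>" and \<psi>: "C_k 1 \<psi>"
    and supp: "\<And>z. z \<notin> cball c r \<Longrightarrow> \<eta> z = 0"
  shows "(LINT z|lborel. frechet_derivative \<eta> (at z) v * frechet_derivative \<psi> (at z) w)
    = (LINT z|lborel. frechet_derivative \<eta> (at z) w * frechet_derivative \<psi> (at z) v)"
proof -
  define s where "s n = inverse (real (Suc n))" for n
  have s: "0 < s n" "s n \<le> 1" for n by (simp_all add: s_def field_simps)
  define E where "E v w n =
      (\<lambda>z. ((\<eta> (z + s n *\<^sub>R v) - \<eta> z) /\<^sub>R s n) * ((\<psi> (z + s n *\<^sub>R (- w)) - \<psi> z) /\<^sub>R s n))" for v w n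
  note c\<eta> = C_k_1_D(3)[OF \<eta>] and c\<psi> = C_k_1_D(3)[OF \<psi>]
  have sym: "integral\<^sup>L lborel (E v w n) = integral\<^sup>L lborel (E w v n)" for v w n
  proof -
    have "E v w n = (\<lambda>z. (inverse (s n) * inverse (s n)) *\<^sub>R
        ((\<eta> (z + s n *\<^sub>R v) - \<eta> z) * (\<psi> (z - s n *\<^sub>R w) - \<psi> z)))" for v w
      by (simp add: E_def)
    moreover have "(LINT z|lborel. (\<eta> (z + s n *\<^sub>R v) - \<eta> z) * (\<psi> (z - s n *\<^sub>R w) - \<psi> z))
        = (LINT z|lborel. (\<eta> (z + s n *\<^sub>R w) - \<eta> z) * (\<psi> (z - s n *\<^sub>R v) - \<psi> z))"
      by (rule integral_difference_product_commute[OF c\<eta> c\<psi>]) (rule supp)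
    ultimately show ?thesis
      by (simp only: integral_scaleR_right)
  qed
  have lim: "(\<lambda>n. integral\<^sup>L lborel (E v w n))
      \<longlonglongrightarrow> (LINT z|lborel. frechet_derivative \<eta> (at z) v * frechet_derivative \<psi> (at z) (- w))" for v w
  proof -
    \<comment> \<open>For z outside this larger ball, both z and the shifted point lie off the
      support of \<eta>, so the quotient vanishes for all n and an indicator can dominate.\<close>
    let ?R = "r + norm v"
    obtain B1 where B1: "0 \<le> B1" "\<And>z s. z \<in> cball c ?R \<Longrightarrow> 0 < s \<Longrightarrow> s \<le> 1 \<Longrightarrow>
        norm ((\<eta> (z + s *\<^sub>R v) - \<eta> z) /\<^sub>R s) \<le> B1"
      using C_k_1_difference_quotient_bounded[OF \<eta>, where c=c and R="?R" and v=v] by blast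
    obtain B2 where B2: "0 \<le> B2" "\<And>z s. z \<in> cball c ?R \<Longrightarrow> 0 < s \<Longrightarrow> s \<le> 1 \<Longrightarrow>
        norm ((\<psi> (z + s *\<^sub>R (- w)) - \<psi> z) /\<^sub>R s) \<le> B2"
      using C_k_1_difference_quotient_bounded[OF \<psi>, where c=c and R="?R" and v="- w"] by blast
    show ?thesis
    proof (rule integral_dominated_convergence[where w="\<lambda>z. indicator (cball c ?R) z *\<^sub>R (B1 * B2)"])
      show "(\<lambda>z. frechet_derivative \<eta> (at z) v * frechet_derivative \<psi> (at z) (- w)) \<in> borel_measurable lborel"
        using C_k_1_D(2)[OF \<eta>] C_k_1_D(2)[OF \<psi>]
        by (auto intro!: borel_measurable_continuous_onI continuous_intros)
      show "E v w n \<in> borel_measurable lborel" for n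
        unfolding E_def
        by (auto intro!: borel_measurable_continuous_onI continuous_intros
            continuous_on_compose2[OF c\<eta>] continuous_on_compose2[OF c\<psi>])
      show "integrable lborel (\<lambda>z. indicator (cball c ?R) z *\<^sub>R (B1 * B2))"
        by (intro borel_integrable_compact) auto
      show "AE z in lborel. (\<lambda>n. E v w n z)
          \<longlonglongrightarrow> frechet_derivative \<eta> (at z) v * frechet_derivative \<psi> (at z) (- w)"
        unfolding E_def s_def
        by (intro always_eventually allI tendsto_mult C_k_1_difference_quotient_tendsto \<eta> \<psi>)
      show "AE z in lborel. norm (E v w n z) \<le> indicator (cball c ?R) z *\<^sub>R (B1 * B2)" for n
      proof (intro always_eventually allI)
        fix z
        show "norm (E v w n z) \<le> indicator (cball c ?R) z *\<^sub>R (B1 * B2)"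
        proof (cases "z \<in> cball c ?R")
          case True
          then show ?thesis
            using mult_mono[OF B1(2)[OF True s] B2(2)[OF True s] B1(1) norm_ge_zero]
            by (simp only: E_def norm_mult indicator_simps(1) scaleR_one)
        next
          case False
          have "norm (s n *\<^sub>R v) \<le> norm v" using s[of n] by (simp add: mult_left_le_one_le)
          then have "z + s n *\<^sub>R v \<notin> cball c r" "z \<notin> cball c r"
            using False norm_triangle_ineq4[of "z + s n *\<^sub>R v - c" "s n *\<^sub>R v"] norm_ge_zero[of v]
            by (auto simp: dist_norm norm_minus_commute algebra_simps simp del: norm_ge_zero)
          then show ?thesis using supp False by (simp add: E_def)
        qed
      qed
    qed
  qed
  have neg: "frechet_derivative \<psi> (at z) (- w) = - frechet_derivative \<psi> (at z) w" for z w
    using C_k_1_D(1)[OF \<psi>] by (simp add: linear_frechet_derivative linear_neg)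
  have "(LINT z|lborel. frechet_derivative \<eta> (at z) v * frechet_derivative \<psi> (at z) (- w))
    = (LINT z|lborel. frechet_derivative \<eta> (at z) w * frechet_derivative \<psi> (at z) (- v))"
    using LIMSEQ_unique[OF lim[of v w]] lim[of w v] unfolding sym[of v w] by simp
  then show ?thesis unfolding neg by simp
qed

text \<open>Distributions integrate over \<Omega>, while translation invariance needs the whole
  space; a support inside \<Omega> reconciles the two.\<close>

lemma integral_lebesgue_on_eq_lborel:
  fixes h :: "'a::euclidean_space \<Rightarrow> complex"
  assumes op: "open \<Omega>" and sub: "cball c r \<subseteq> \<Omega>" and h: "continuous_on UNIV h"
    and supp: "\<And>z. z \<notin> cball c r \<Longrightarrow> h z = 0"
  shows "(LINT z|lebesgue_on \<Omega>. h z) = (LINT z|lborel. h z)"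
proof -
  have "(LINT z|lebesgue_on \<Omega>. h z) = (LINT z|lebesgue. indicator \<Omega> z *\<^sub>R h z)"
    using op by (intro integral_restrict_space) auto
  also have "(\<lambda>z. indicator \<Omega> z *\<^sub>R h z) = h"
    using sub supp by (intro ext) (metis indicator_simps scaleR_one scaleR_zero_left subsetD)
  also have "(LINT z|lebesgue. h z) = (LINT z|lborel. h z)"
    using h by (intro integral_completion) (auto intro: borel_measurable_continuous_onI)
  finally show ?thesis .
qed

lemma frechet_derivative_zero_outside:
  fixes \<eta> :: "'a::euclidean_space \<Rightarrow> complex"
  assumes supp: "\<And>z. z \<notin> cball c r \<Longrightarrow> \<eta> z = 0" and z: "z \<notin> cball c r"
  shows "frechet_derivative \<eta> (at z) v = 0"
proof -
  have "((\<lambda>_. 0 :: complex) has_derivative (\<lambda>_. 0)) (at z)" by simp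
  then have "(\<eta> has_derivative (\<lambda>_. 0)) (at z)"
    by (rule has_derivative_transform_within_open[of _ _ _ _ "- cball c r"]) (use z supp in auto)
  then show ?thesis using frechet_derivative_at by metis
qed

text \<open>The weak form of dbar dbar = 0: expand both Wirtinger derivatives into real directions
  and exchange directions term by term.\<close>

lemma integral_d_zbar_commute:
  fixes \<eta> \<psi> :: "('n::finite) cspace \<Rightarrow> complex"
  assumes \<eta>: "C_k 1 \<eta>" and \<psi>: "C_k 1 \<psi>"
    and supp: "\<And>z. z \<notin> cball c r \<Longrightarrow> \<eta> z = 0"
  shows "(LINT z|lborel. d_zbar a \<eta> z * d_zbar b \<psi> z) = (LINT z|lborel. d_zbar b \<eta> z * d_zbar a \<psi> z)"
proof -
  define A where "A v w = (LINT z|lborel. frechet_derivative \<eta> (at z) v * frechet_derivative \<psi> (at z) w)" for v w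
  have comm: "A v w = A w v" for v w
    unfolding A_def by (rule integral_directional_derivatives_commute[OF \<eta> \<psi>]) (rule supp)
  have int: "integrable lborel (\<lambda>z. frechet_derivative \<eta> (at z) v * frechet_derivative \<psi> (at z) w)" for v w
  proof (rule integrable_continuous_compact_support)
    show "continuous_on UNIV (\<lambda>z. frechet_derivative \<eta> (at z) v * frechet_derivative \<psi> (at z) w)"
      by (intro continuous_intros C_k_1_D(2) \<eta> \<psi>)
    show "frechet_derivative \<eta> (at z) v * frechet_derivative \<psi> (at z) w = 0" if "z \<notin> cball c r" for z
      using frechet_derivative_zero_outside[of c r \<eta> z v] supp that by auto
  qed
  have "(LINT z|lborel. d_zbar a \<eta> z * d_zbar b \<psi> z) =
      (A (axis a 1) (axis b 1) + \<i> * A (axis a \<i>) (axis b 1) + \<i> * A (axis a 1) (axis b \<i>)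
        - A (axis a \<i>) (axis b \<i>)) / 4" for a b
  proof -
    have "d_zbar a \<eta> z * d_zbar b \<psi> z =
      (frechet_derivative \<eta> (at z) (axis a 1) * frechet_derivative \<psi> (at z) (axis b 1)
      + \<i> * (frechet_derivative \<eta> (at z) (axis a \<i>) * frechet_derivative \<psi> (at z) (axis b 1))
      + \<i> * (frechet_derivative \<eta> (at z) (axis a 1) * frechet_derivative \<psi> (at z) (axis b \<i>))
      - frechet_derivative \<eta> (at z) (axis a \<i>) * frechet_derivative \<psi> (at z) (axis b \<i>)) / 4" for z
      by (simp add: d_zbar_def algebra_simps)
    then show ?thesis
      by (simp only: A_def int integral_divide_zero integral_mult_right_zero integrable_mult_right
          Bochner_Integration.integral_add Bochner_Integration.integral_diff
          Bochner_Integration.integrable_add)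
  qed
  from this[of a b] this[of b a] show ?thesis
    by (simp only: comm[of "axis b _" "axis a _"] add_ac)
qed

section \<open>An explicit C1 bump and its dbar\<close>

text \<open>Squaring the positive part gives just enough regularity for \<open>C_k 1\<close>, and
  the quadratic polynomial inside keeps the derivatives explicit.\<close>

definition bump :: "'a::euclidean_space \<Rightarrow> real \<Rightarrow> 'a \<Rightarrow> complex" where
  "bump c r z = of_real ((max 0 (r\<^sup>2 - (z - c) \<bullet> (z - c)))\<^sup>2)"

lemma has_real_derivative_positive_part_square:
  "((\<lambda>t::real. (max 0 t)\<^sup>2) has_real_derivative 2 * max 0 t) (at t)"
proof -
  consider "t > 0" | "t < 0" | "t = 0" by linarith
  then show ?thesis
  proof cases
    case 1
    have "((\<lambda>t::real. t\<^sup>2) has_real_derivative 2 * t) (at t)"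
      by (auto intro!: derivative_eq_intros)
    then have "((\<lambda>t::real. (max 0 t)\<^sup>2) has_real_derivative 2 * t) (at t)"
      by (rule has_field_derivative_transform_within_open[where S="{0<..}"]) (use 1 in auto)
    then show ?thesis using 1 by simp
  next
    case 2
    have "((\<lambda>t::real. 0) has_real_derivative 0) (at t)" by simp
    then have "((\<lambda>t::real. (max 0 t)\<^sup>2) has_real_derivative 0) (at t)"
      by (rule has_field_derivative_transform_within_open[where S="{..<0}"]) (use 2 in auto)
    then show ?thesis using 2 by simp
  next
    case 3
    have "((\<lambda>h::real. (max 0 h)\<^sup>2 / h) \<longlongrightarrow> 0) (at 0)"
    proof (rule Lim_null_comparison)
      show "\<forall>\<^sub>F h in at 0. norm ((max 0 h)\<^sup>2 / h) \<le> \<bar>h\<bar>"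
        by (intro always_eventually allI) (auto simp: max_def power2_eq_square)
      show "((\<lambda>h::real. \<bar>h\<bar>) \<longlongrightarrow> 0) (at 0)"
        using tendsto_rabs_zero[OF tendsto_ident_at] by simp
    qed
    then show ?thesis using 3 by (simp add: DERIV_def)
  qed
qed

lemma bump_has_derivative:
  "(bump c r has_derivative (\<lambda>v. of_real (- 4 * max 0 (r\<^sup>2 - (z - c) \<bullet> (z - c)) * ((z - c) \<bullet> v)))) (at z)"
proof -
  have "((\<lambda>z. r\<^sup>2 - (z - c) \<bullet> (z - c)) has_derivative (\<lambda>v. - 2 * ((z - c) \<bullet> v))) (at z)"
    by (auto intro!: derivative_eq_intros simp: inner_commute)
  moreover have "((\<lambda>t. (max 0 t)\<^sup>2) has_derivative (*) (2 * max 0 (r\<^sup>2 - (z - c) \<bullet> (z - c))))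
      (at (r\<^sup>2 - (z - c) \<bullet> (z - c)))"
    using has_real_derivative_positive_part_square by (simp add: has_field_derivative_def)
  ultimately have "((\<lambda>z. (max 0 (r\<^sup>2 - (z - c) \<bullet> (z - c)))\<^sup>2) has_derivative
      (\<lambda>v. 2 * max 0 (r\<^sup>2 - (z - c) \<bullet> (z - c)) * (- 2 * ((z - c) \<bullet> v)))) (at z)"
    by (rule has_derivative_compose)
  from has_derivative_of_real[OF this, where ?'a=complex] show ?thesis
    unfolding bump_def by (simp add: mult.assoc mult.left_commute[of _ "-2"])
qed

lemma frechet_derivative_bump:
  "frechet_derivative (bump c r) (at z) v
    = of_real (- 4 * max 0 (r\<^sup>2 - (z - c) \<bullet> (z - c)) * ((z - c) \<bullet> v))"
  by (rule fun_cong[OF frechet_derivative_at[OF bump_has_derivative], symmetric])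

lemma C_k_1_bump: "C_k 1 (bump c r)"
  unfolding One_nat_def C_k.simps frechet_derivative_bump
  by (auto intro!: continuous_intros differentiableI[OF bump_has_derivative])

lemma bump_zero_outside:
  assumes "0 \<le> r" "z \<notin> cball c r"
  shows "bump c r z = 0"
proof -
  have "r\<^sup>2 \<le> (norm (z - c))\<^sup>2"
    using assms by (intro power_mono) (auto simp: dist_norm norm_minus_commute)
  then show ?thesis by (simp add: bump_def power2_norm_eq_inner)
qed

text \<open>The real inner products of z - c with the directions 1 and i on axis k are the real and
  imaginary parts of its k-th coordinate, which the Wirtinger combination reassembles. Inside the
  ball the zeros form just the hyperplane where the k-th coordinates of z and c agree.\<close>

lemma d_zbar_bump:
  "d_zbar k (bump c r) z = of_real (- 2 * max 0 (r\<^sup>2 - (z - c) \<bullet> (z - c))) * (z $ k - c $ k)"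
proof -
  define m where "m = max 0 (r\<^sup>2 - (z - c) \<bullet> (z - c))"
  show ?thesis
    unfolding d_zbar_def frechet_derivative_bump m_def[symmetric]
    by (simp add: inner_axis inner_complex_def complex_eq_iff)
qed

text \<open>
  Up to sign this is \<open>\<partial>\<close>-bar of the form with the single coefficient \<open>\<eta>\<close> at dz_I0 wedge dzbar_J0; the sum
  has at most one term.
\<close>

definition dbar_monomial ::
  "('n::{finite,linorder} cspace \<Rightarrow> complex) \<Rightarrow> 'n set \<Rightarrow> 'n set \<Rightarrow> 'n form" where
  "dbar_monomial \<eta> I0 J0 z I J = (if I = I0 then
     \<Sum>l | l \<notin> J0 \<and> J = insert l J0. (-1) ^ card {j \<in> J0. j < l} * d_zbar l \<eta> z else 0)"

lemma dbar_monomial_insert: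
  assumes "l \<notin> J0"
  shows "dbar_monomial \<eta> I0 J0 z I0 (insert l J0) = (-1) ^ card {j \<in> J0. j < l} * d_zbar l \<eta> z"
proof -
  have "{l'. l' \<notin> J0 \<and> insert l J0 = insert l' J0} = {l}" using assms by auto
  then show ?thesis by (simp add: dbar_monomial_def)
qed

lemma dbar_monomial_eq_0:
  assumes "I \<noteq> I0 \<or> (\<forall>l. l \<notin> J0 \<longrightarrow> J \<noteq> insert l J0)"
  shows "dbar_monomial \<eta> I0 J0 z I J = 0"
  using assms by (auto simp: dbar_monomial_def intro!: sum.neutral)

lemma dbar_monomial_L2:
  fixes \<Omega> :: "('n::{finite,linorder}) cspace set"
  assumes "bounded \<Omega>" "open \<Omega>" and \<eta>: "C_k 1 \<eta>" and card: "card I0 = p" "card J0 + 1 = q"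
  shows "dbar_monomial \<eta> I0 J0 \<in> L2 \<Omega> p q"
  unfolding L2_iff
proof (intro conjI allI impI)
  fix z and I J :: "'n set"
  assume "\<not> (card I = p \<and> card J = q)"
  then show "dbar_monomial \<eta> I0 J0 z I J = 0"
    using card by (intro dbar_monomial_eq_0) auto
next
  fix I J :: "'n set"
  have "continuous_on UNIV (d_zbar l \<eta>)" for l
    unfolding d_zbar_def by (intro continuous_intros C_k_1_D(2)[OF \<eta>]) auto
  then have "continuous_on UNIV (\<lambda>z. dbar_monomial \<eta> I0 J0 z I J)"
    unfolding dbar_monomial_def by (cases "I = I0") (auto intro!: continuous_intros)
  then show "square_integrable (lebesgue_on \<Omega>) (\<lambda>z. dbar_monomial \<eta> I0 J0 z I J)"
    by (rule square_integrable_continuous[OF assms(1,2)])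
qed

text \<open>A coefficient of dbar dbar \<eta> can be nonzero only if K is J0 with two further
  indices a < b. The contributions of a and b carry the same integral by the weak symmetry, with
  opposite signs.\<close>

lemma dbar_monomial_K2:
  fixes \<Omega> :: "('n::{finite,linorder}) cspace set"
  assumes bd: "bounded \<Omega>" and op: "open \<Omega>" and \<eta>: "C_k 1 \<eta>"
    and sub: "cball c r \<subseteq> \<Omega>" and supp: "\<And>z. z \<notin> cball c r \<Longrightarrow> \<eta> z = 0"
    and card: "card I0 = p" "card J0 + 1 = q"
  shows "dbar_monomial \<eta> I0 J0 \<in> K2 \<Omega> p q"
  unfolding K2_def
proof (intro CollectI conjI allI impI dbar_monomial_L2[OF bd op \<eta> card])
  fix I K :: "'n set" and \<psi>
  assume K: "card K = q + 1" and \<psi>: "test_function \<Omega> \<psi>"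
  let ?f = "dbar_monomial \<eta> I0 J0"
  define S where "S l k = (LINT z|lebesgue_on \<Omega>. d_zbar l \<eta> z * d_zbar k \<psi> z)" for l k
  have \<psi>1: "C_k 1 \<psi>" using \<psi> unfolding test_function_def by blast
  have cd: "continuous_on UNIV (d_zbar l \<eta>)" "continuous_on UNIV (d_zbar l \<psi>)" for l
    unfolding d_zbar_def by (intro continuous_intros C_k_1_D(2) \<eta> \<psi>1; simp)+
  have "S l k = (LINT z|lborel. d_zbar l \<eta> z * d_zbar k \<psi> z)" for l k
    unfolding S_def
  proof (rule integral_lebesgue_on_eq_lborel[OF op sub])
    show "continuous_on UNIV (\<lambda>z. d_zbar l \<eta> z * d_zbar k \<psi> z)" by (intro continuous_intros cd)
    show "d_zbar l \<eta> z * d_zbar k \<psi> z = 0" if "z \<notin> cball c r" for z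
      using frechet_derivative_zero_outside[of c r \<eta> z] supp that by (auto simp: d_zbar_def)
  qed
  moreover have "(LINT z|lborel. d_zbar a \<eta> z * d_zbar b \<psi> z) = (LINT z|lborel. d_zbar b \<eta> z * d_zbar a \<psi> z)" for a b
    by (rule integral_d_zbar_commute[OF \<eta> \<psi>1]) (rule supp)
  ultimately have S: "S a b = S b a" for a b by simp
  let ?t = "\<lambda>k. (-1) ^ card {j \<in> K. j < k} * (- (LINT z|lebesgue_on \<Omega>. ?f z I (K - {k}) * d_zbar k \<psi> z)) :: complex"
  have "(\<Sum>k\<in>K. ?t k) = 0"
  proof (cases "I = I0 \<and> J0 \<subseteq> K")
    case False
    have "?f z I (K - {k}) = 0" for z k
      using False by (intro dbar_monomial_eq_0) blast
    then show ?thesis by simp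
  next
    case True
    then have "card (K - J0) = 2"
      using K card by (simp add: card_Diff_subset)
    then obtain a b where ab: "K - J0 = {a, b}" "a < b"
      by (metis card_2_iff insert_commute linorder_neqE)
    have notin: "a \<notin> J0" "b \<notin> J0" and K_eq: "K = insert a (insert b J0)" using ab True by auto
    \<comment> \<open>Removing an index of J0 leaves a set that no longer contains J0, where the
      form has no coefficient.\<close>
    have "?t k = 0" if "k \<in> J0" for k
    proof -
      have "?f z I (K - {k}) = 0" for z
        using that by (intro dbar_monomial_eq_0) blast
      then show ?thesis by simp
    qed
    then have "(\<Sum>k\<in>K. ?t k) = (\<Sum>k\<in>{a, b}. ?t k)"
      using ab by (intro sum.mono_neutral_right) auto
    also have "\<dots> = ?t a + ?t b" using ab by simp
    also have "?t a = - ((-1) ^ card {j \<in> J0. j < a} * (-1) ^ card {j \<in> J0. j < b} * S a b)"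
    proof -
      have "K - {a} = insert b J0" "{j \<in> K. j < a} = {j \<in> J0. j < a}"
        using ab notin K_eq by auto
      then show ?thesis
        using True notin by (simp add: dbar_monomial_insert mult.assoc S_def[symmetric] S[of b a])
    qed
    also have "?t b = (-1) ^ card {j \<in> J0. j < a} * (-1) ^ card {j \<in> J0. j < b} * S a b"
    proof -
      \<comment> \<open>Here a precedes b, so the count gains one element; this is the sign that
        cancels the contribution of a.\<close>
      have "K - {b} = insert a J0" "{j \<in> K. j < b} = insert a {j \<in> J0. j < b}"
        using ab notin K_eq by auto
      then show ?thesis
        using True notin by (simp add: dbar_monomial_insert mult.assoc S_def[symmetric])
    qed
    finally show ?thesis by simp
  qed
  then show "dbar_dist \<Omega> p ?f I K \<psi> = 0" by (simp add: dbar_dist_def)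
qed

section \<open>Compactness\<close>

lemma mult_op_L2:
  assumes "f \<in> L2 \<Omega> p q" "\<phi> \<in> Linfty \<Omega>"
  shows "mult_op \<phi> f \<in> L2 \<Omega> p q"
  using assms unfolding L2_iff Linfty_def mult_op_def
  by (auto intro: square_integrable_bounded_mult)

lemma mult_op_const_K2:
  assumes "bounded \<Omega>" "open \<Omega>" "f \<in> K2 \<Omega> p q"
  shows "mult_op (\<lambda>_. c) f \<in> K2 \<Omega> p q"
proof -
  have "mult_op (\<lambda>_. c) f = form_lin c (\<lambda>z I J. 0) f" by (simp add: mult_op_def form_lin_def)
  then show ?thesis using K2_form_lin[OF assms(1,2) zero_form_K2 assms(3)] by simp
qed

lemma L2_norm_le_pointwise:
  assumes e: "e \<in> L2 \<Omega> p q" and f: "f \<in> L2 \<Omega> p q" and C: "0 \<le> C"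
    and le: "\<And>z I J. z \<in> \<Omega> \<Longrightarrow> cmod (e z I J) \<le> C * cmod (f z I J)"
  shows "L2_norm \<Omega> p q e \<le> C * L2_norm \<Omega> p q f"
proof -
  have "(LINT z|lebesgue_on \<Omega>. (cmod (e z I J))\<^sup>2) \<le> C\<^sup>2 * (LINT z|lebesgue_on \<Omega>. (cmod (f z I J))\<^sup>2)"
    for I J
  proof -
    have "(LINT z|lebesgue_on \<Omega>. (cmod (e z I J))\<^sup>2) \<le> (LINT z|lebesgue_on \<Omega>. C\<^sup>2 * (cmod (f z I J))\<^sup>2)"
    proof (rule integral_mono)
      show "(cmod (e z I J))\<^sup>2 \<le> C\<^sup>2 * (cmod (f z I J))\<^sup>2" if "z \<in> space (lebesgue_on \<Omega>)" for z
        using that power_mono[OF le[of z I J], of 2] by (simp add: power_mult_distrib)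
    qed (use L2_square_integrable[OF e] L2_square_integrable[OF f] in \<open>auto simp: square_integrable_def\<close>)
    then show ?thesis by simp
  qed
  then have "(L2_norm \<Omega> p q e)\<^sup>2 \<le> (C * L2_norm \<Omega> p q f)\<^sup>2"
    unfolding L2_norm_square power_mult_distrib sum_distrib_left by (intro sum_mono)
  then show ?thesis by - (rule power2_le_imp_le, simp_all add: C)
qed

text \<open>The form is the normalized dbar of a bump times a monomial of degree (p, q - 1).
  Normalization requires one coefficient that is nonzero on a set of positive measure.\<close>

lemma exists_unit_form_K2_in_cball:
  fixes \<Omega> :: "('n::{finite,linorder}) cspace set"
  assumes bd: "bounded \<Omega>" and op: "open \<Omega>" and sub: "cball c r \<subseteq> \<Omega>" and r: "0 < r"
    and p: "p \<le> CARD('n)" and q: "1 \<le> q" "q \<le> CARD('n)"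
  shows "\<exists>f\<in>K2 \<Omega> p q. L2_norm \<Omega> p q f = 1 \<and> (\<forall>z I J. z \<notin> cball c r \<longrightarrow> f z I J = 0)"
proof -
  obtain I0 :: "'n set" where I0: "card I0 = p"
    using obtain_subset_with_card_n[OF p] by blast
  obtain J0 :: "'n set" where J0: "card J0 = q - 1"
  proof -
    have "q - 1 \<le> CARD('n)" using q by simp
    then show thesis using that obtain_subset_with_card_n by blast
  qed
  have J0q: "card J0 + 1 = q" using J0 q by simp
  \<comment> \<open>Having only q - 1 < n elements, J0 misses an index l in whose direction dbar can
    act.\<close>
  have "J0 \<noteq> UNIV" using J0 q by auto
  then obtain l where l: "l \<notin> J0" by blast
  define h where "h = dbar_monomial (bump c r) I0 J0"
  have supp: "bump c r z = 0" if "z \<notin> cball c r" for z using bump_zero_outside[of r z c] r that by simp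
  have hK: "h \<in> K2 \<Omega> p q"
    unfolding h_def by (rule dbar_monomial_K2[OF bd op C_k_1_bump sub _ I0 J0q]) (rule supp)
  have hL: "h \<in> L2 \<Omega> p q" by (rule K2_imp_L2[OF hK])
  \<comment> \<open>The bump is the square of the factor occurring in its dbar, so both vanish at
    the same points.\<close>
  have h0: "h z I J = 0" if "z \<notin> cball c r" for z I J
  proof -
    have "max 0 (r\<^sup>2 - (z - c) \<bullet> (z - c)) = 0"
      using supp[OF that] unfolding bump_def of_real_eq_0_iff power_eq_0_iff by blast
    then show ?thesis by (simp add: h_def dbar_monomial_def d_zbar_bump)
  qed
  have "L2_norm \<Omega> p q h \<noteq> 0"
  proof
    assume "L2_norm \<Omega> p q h = 0"
    let ?g = "\<lambda>z. h z I0 (insert l J0)"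
    have g2: "(cmod (?g z))\<^sup>2 = (cmod (d_zbar l (bump c r) z))\<^sup>2" for z
      unfolding h_def dbar_monomial_insert[OF l] by (simp add: norm_mult norm_power)
    have "(LINT z|lebesgue_on \<Omega>. (cmod (?g z))\<^sup>2) \<le> 0"
      using L2_coefficient_le_norm[OF hL, of I0 "insert l J0"] \<open>L2_norm \<Omega> p q h = 0\<close> by simp
    moreover have "0 \<le> (LINT z|lebesgue_on \<Omega>. (cmod (?g z))\<^sup>2)" by (intro integral_nonneg_AE) auto
    moreover have "integrable (lebesgue_on \<Omega>) (\<lambda>z. (cmod (?g z))\<^sup>2)"
      using L2_square_integrable[OF hL] by (simp add: square_integrable_def)
    ultimately have "AE z in lebesgue_on \<Omega>. (cmod (?g z))\<^sup>2 = 0"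
      by (subst integral_nonneg_eq_0_iff_AE[symmetric]) auto
    then have ae: "AE z in lebesgue. z \<in> \<Omega> \<longrightarrow> d_zbar l (bump c r) z = 0"
      using op unfolding g2 by (simp add: AE_restrict_space_iff)
    \<comment> \<open>The ball minus a complex hyperplane: the chosen coefficient has no zero there,
      and a nonempty open set is not null.\<close>
    define U where "U = ball c r \<inter> {z. z $ l \<noteq> c $ l}"
    have "open U"
      unfolding U_def by (intro open_Int open_ball open_Collect_neq continuous_intros)
    have nz: "d_zbar l (bump c r) z \<noteq> 0" if "z \<in> U" for z
    proof -
      have "(norm (z - c))\<^sup>2 < r\<^sup>2"
        using that r by (intro power_strict_mono) (auto simp: U_def dist_norm norm_minus_commute)
      then have "max 0 (r\<^sup>2 - (z - c) \<bullet> (z - c)) \<noteq> 0" by (simp add: power2_norm_eq_inner)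
      then show ?thesis
        using that unfolding d_zbar_bump mult_eq_0_iff of_real_eq_0_iff by (simp add: U_def)
    qed
    have "AE z in lebesgue. z \<notin> U"
      using ae by eventually_elim (use nz sub in \<open>auto simp: U_def subset_iff\<close>)
    then have "U \<in> null_sets lebesgue"
      using \<open>open U\<close> by (subst (asm) AE_iff_null_sets[symmetric]) auto
    then have "U = {}"
      using \<open>open U\<close> open_not_negligible by (auto simp: negligible_iff_null_sets)
    moreover have "c + (r / 2) *\<^sub>R axis l 1 \<in> U"
    proof -
      have "norm (axis l (1 :: complex)) = 1"
        by (simp add: norm_eq_sqrt_inner inner_axis_axis)
      then show ?thesis using r by (simp add: U_def dist_norm)
    qed
    ultimately show False by blast
  qed
  then have pos: "0 < L2_norm \<Omega> p q h" using L2_norm_nonneg[of \<Omega> p q h] by linarith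
  define f where "f = mult_op (\<lambda>_. of_real (inverse (L2_norm \<Omega> p q h))) h"
  have "f \<in> K2 \<Omega> p q" unfolding f_def by (rule mult_op_const_K2[OF bd op hK])
  moreover have "L2_norm \<Omega> p q f = 1"
    unfolding f_def L2_norm_scale using pos by (simp add: norm_inverse)
  moreover have "f z I J = 0" if "z \<notin> cball c r" for z I J
    using h0[OF that] by (simp add: f_def mult_op_def)
  ultimately show ?thesis by blast
qed

text \<open>Replaces weak convergence of the concentrated unit forms. The integrands are dominated
  by those of g and eventually vanish at every point except c, which is a null set.\<close>

lemma L2_norm_shrinking_balls_tendsto:
  assumes op: "open \<Omega>" and g: "g \<in> L2 \<Omega> p q" and r: "r \<longlonglongrightarrow> 0"
  shows "(\<lambda>n. L2_norm \<Omega> p q (mult_op (indicator (cball c (r n))) g)) \<longlonglongrightarrow> 0"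
proof -
  have "(\<lambda>n. LINT z|lebesgue_on \<Omega>. (cmod (mult_op (indicator (cball c (r n))) g z I J))\<^sup>2)
      \<longlonglongrightarrow> (LINT z|lebesgue_on \<Omega>. 0)" for I J
  proof (rule integral_dominated_convergence[where w="\<lambda>z. (cmod (g z I J))\<^sup>2"])
    have [measurable]: "(\<lambda>z. g z I J) \<in> borel_measurable (lebesgue_on \<Omega>)"
      using L2_square_integrable[OF g] by (simp add: square_integrable_def)
    have [measurable]: "(indicator (cball c s) :: _ \<Rightarrow> complex) \<in> borel_measurable (lebesgue_on \<Omega>)" for s
      by (intro measurable_restrict_space1 borel_measurable_indicator) auto
    show "(\<lambda>z. (cmod (mult_op (indicator (cball c (r n))) g z I J))\<^sup>2) \<in> borel_measurable (lebesgue_on \<Omega>)" for n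
      unfolding mult_op_def by measurable
    show "integrable (lebesgue_on \<Omega>) (\<lambda>z. (cmod (g z I J))\<^sup>2)"
      using L2_square_integrable[OF g] by (simp add: square_integrable_def)
    show "AE z in lebesgue_on \<Omega>. norm ((cmod (mult_op (indicator (cball c (r n))) g z I J))\<^sup>2) \<le> (cmod (g z I J))\<^sup>2" for n
      by (intro always_eventually) (auto simp: mult_op_def indicator_def)
    have "AE z in lebesgue. z \<noteq> c"
      by (intro AE_completion AE_lborel_singleton)
    then have "AE z in lebesgue_on \<Omega>. z \<noteq> c"
      using op by (subst AE_restrict_space_iff) auto
    then show "AE z in lebesgue_on \<Omega>. (\<lambda>n. (cmod (mult_op (indicator (cball c (r n))) g z I J))\<^sup>2) \<longlonglongrightarrow> 0"
    proof eventually_elim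
      case (elim z)
      then have "\<forall>\<^sub>F n in sequentially. r n < dist c z"
        using order_tendstoD(2)[OF r] by simp
      then have "\<forall>\<^sub>F n in sequentially. (cmod (mult_op (indicator (cball c (r n))) g z I J))\<^sup>2 = 0"
        by eventually_elim (simp add: mult_op_def)
      then show ?case by (rule tendsto_eventually)
    qed
  qed simp
  then have "(\<lambda>n. \<Sum>I | card I = p. \<Sum>J | card J = q.
      LINT z|lebesgue_on \<Omega>. (cmod (mult_op (indicator (cball c (r n))) g z I J))\<^sup>2)
      \<longlonglongrightarrow> (\<Sum>I::'a set | card I = p. \<Sum>J::'a set | card J = q. 0)"
    by (intro tendsto_sum) simp
  then have "(\<lambda>n. L2_norm \<Omega> p q (mult_op (indicator (cball c (r n))) g)) \<longlonglongrightarrow> sqrt 0"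
    unfolding L2_norm_def by (intro tendsto_real_sqrt) simp
  then show ?thesis by simp
qed

text \<open>Only the diagonal values of T enter, and W may be any target inside \<open>L2\<close>,
  so both operators are covered. The contradiction comes from a lower bound |\<phi> c| / 2 on these
  values that is uniform in n.\<close>

lemma compact_op_symbol_eq_0:
  fixes \<Omega> :: "('n::{finite,linorder}) cspace set"
  assumes bd: "bounded \<Omega>" and op: "open \<Omega>"
    and p: "p \<le> CARD('n)" and q: "1 \<le> q" "q \<le> CARD('n)"
    and \<phi>: "continuous_on \<Omega> \<phi>" "\<phi> \<in> Linfty \<Omega>"
    and T: "compact_op \<Omega> p q (K2 \<Omega> p q) W T" and W: "W \<subseteq> L2 \<Omega> p q"
    and inner: "\<And>f. f \<in> K2 \<Omega> p q \<Longrightarrow> L2_inner \<Omega> p q (T f) f = L2_inner \<Omega> p q (mult_op \<phi> f) f"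
    and c: "c \<in> \<Omega>"
  shows "\<phi> c = 0"
proof (rule ccontr)
  assume nz: "\<phi> c \<noteq> 0"
  obtain d1 where d1: "0 < d1" "cball c d1 \<subseteq> \<Omega>" using op c open_contains_cball by blast
  obtain d2 where d2: "0 < d2" "\<And>z. z \<in> \<Omega> \<Longrightarrow> dist z c < d2 \<Longrightarrow> dist (\<phi> z) (\<phi> c) < cmod (\<phi> c) / 2"
    using \<phi>(1) c nz unfolding continuous_on_iff by (metis half_gt_zero zero_less_norm_iff)
  \<comment> \<open>Halving d2 turns the strict distance bound into one valid on the closed
    ball.\<close>
  define d where "d = min d1 (d2 / 2)"
  have d: "0 < d" "cball c d \<subseteq> \<Omega>" using d1 d2(1) by (auto simp: d_def)
  have close: "cmod (\<phi> z - \<phi> c) \<le> cmod (\<phi> c) / 2" if "z \<in> cball c d" for z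
    using d2(2)[of z] that d(2) d2(1) by (auto simp: d_def dist_norm norm_minus_commute subset_iff)
  define s where "s n = d / real (Suc n)" for n
  have s: "0 < s n" "s n \<le> d" for n using d(1) by (auto simp: s_def field_simps)
  have s_lim: "s \<longlonglongrightarrow> 0"
    unfolding s_def by (intro LIMSEQ_Suc lim_const_over_n)
  have "\<exists>f\<in>K2 \<Omega> p q. L2_norm \<Omega> p q f = 1 \<and> (\<forall>z I J. z \<notin> cball c (s n) \<longrightarrow> f z I J = 0)" for n
  proof (rule exists_unit_form_K2_in_cball[OF bd op _ s(1) p q])
    show "cball c (s n) \<subseteq> \<Omega>" using d(2) s(2)[of n] by (meson order_trans subset_cball)
  qed
  then obtain F where F: "\<And>n. F n \<in> K2 \<Omega> p q" "\<And>n. L2_norm \<Omega> p q (F n) = 1"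
      "\<And>n z I J. z \<notin> cball c (s n) \<Longrightarrow> F n z I J = 0"
    by metis
  have FL: "F n \<in> L2 \<Omega> p q" for n using F(1) by (rule K2_imp_L2)
  have lower: "cmod (\<phi> c) / 2 \<le> cmod (L2_inner \<Omega> p q (mult_op \<phi> (F n)) (F n))" for n
  proof -
    \<comment> \<open>The error (\<phi> - \<phi> c) F n has norm at most |\<phi> c| / 2 because F n
      lives where \<phi> is that close to \<phi> c, while the main term is \<phi> c times a unit
      norm.\<close>
    define e where "e = form_lin (- \<phi> c) (mult_op \<phi> (F n)) (F n)"
    have mL: "mult_op \<phi> (F n) \<in> L2 \<Omega> p q" by (rule mult_op_L2[OF FL \<phi>(2)])
    have eL: "e \<in> L2 \<Omega> p q" unfolding e_def by (rule form_lin_L2[OF mL FL])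
    have "cmod (e z I J) \<le> cmod (\<phi> c) / 2 * cmod (F n z I J)" for z I J
    proof (cases "z \<in> cball c (s n)")
      case True
      then have "z \<in> cball c d" using s(2)[of n] by simp
      moreover have "e z I J = (\<phi> z - \<phi> c) * F n z I J"
        by (simp add: e_def form_lin_def mult_op_def algebra_simps)
      ultimately show ?thesis
        using close by (simp only: norm_mult mult_right_mono norm_ge_zero)
    next
      case False
      then show ?thesis using F(3) by (simp add: e_def form_lin_def mult_op_def)
    qed
    then have "L2_norm \<Omega> p q e \<le> cmod (\<phi> c) / 2 * L2_norm \<Omega> p q (F n)"
      by (intro L2_norm_le_pointwise eL FL) auto
    then have "cmod (L2_inner \<Omega> p q e (F n)) \<le> cmod (\<phi> c) / 2"
      using L2_Cauchy_Schwarz[OF eL FL[of n]] F(2) by simp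
    moreover have "L2_inner \<Omega> p q e (F n) = L2_inner \<Omega> p q (mult_op \<phi> (F n)) (F n) - \<phi> c"
      unfolding e_def L2_inner_lin_left[OF mL FL FL] by (simp add: L2_inner_self F(2))
    moreover have "cmod (\<phi> c) - cmod (L2_inner \<Omega> p q (mult_op \<phi> (F n)) (F n))
        \<le> cmod (L2_inner \<Omega> p q (mult_op \<phi> (F n)) (F n) - \<phi> c)"
      by (metis norm_minus_commute norm_triangle_ineq2)
    ultimately show ?thesis by simp
  qed
  have TW: "T f \<in> W" if "f \<in> K2 \<Omega> p q" for f using T that by (auto simp: compact_op_def)
  obtain g k where g: "g \<in> W" and k: "strict_mono (k :: nat \<Rightarrow> nat)"
      and lim: "(\<lambda>j. L2_norm \<Omega> p q (form_diff (T (F (k j))) g)) \<longlonglongrightarrow> 0"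
  proof -
    have "\<forall>j. F j \<in> K2 \<Omega> p q \<and> L2_norm \<Omega> p q (F j) \<le> 1" using F by simp
    then show thesis using T that unfolding compact_op_def by blast
  qed
  have gL: "g \<in> L2 \<Omega> p q" using g W by blast
  \<comment> \<open>Subtract g from T (F n); in the remaining pairing g may be cut down to the ball
    carrying F n. Both right-hand terms vanish in the limit along k.\<close>
  have upper: "cmod (\<phi> c) / 2 \<le> L2_norm \<Omega> p q (form_diff (T (F n)) g)
      + L2_norm \<Omega> p q (mult_op (indicator (cball c (s n))) g)" for n
  proof -
    have TL: "T (F n) \<in> L2 \<Omega> p q" using TW[OF F(1)] W by blast
    have iL: "mult_op (indicator (cball c (s n))) g \<in> L2 \<Omega> p q"
    proof (rule mult_op_L2[OF gL])
      have "(indicator (cball c (s n)) :: _ \<Rightarrow> complex) \<in> borel_measurable (lebesgue_on \<Omega>)"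
        by (intro measurable_restrict_space1 borel_measurable_indicator) auto
      moreover have "cmod (indicator (cball c (s n)) z) \<le> 1" for z by (simp add: indicator_def)
      ultimately show "indicator (cball c (s n)) \<in> Linfty \<Omega>" by (auto simp: Linfty_def)
    qed
    have "L2_inner \<Omega> p q g (F n) = L2_inner \<Omega> p q (mult_op (indicator (cball c (s n))) g) (F n)"
    proof -
      have "g z I J * cnj (F n z I J) = mult_op (indicator (cball c (s n))) g z I J * cnj (F n z I J)" for z I J
        using F(3)[of z n I J] by (cases "z \<in> cball c (s n)") (auto simp: mult_op_def)
      then show ?thesis unfolding L2_inner_def by presburger
    qed
    then have "L2_inner \<Omega> p q (mult_op \<phi> (F n)) (F n) = L2_inner \<Omega> p q (form_diff (T (F n)) g) (F n)
        + L2_inner \<Omega> p q (mult_op (indicator (cball c (s n))) g) (F n)"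
      using L2_inner_diff_left[OF TL gL FL] inner[OF F(1)] by simp
    then have "cmod (\<phi> c) / 2 \<le> cmod (L2_inner \<Omega> p q (form_diff (T (F n)) g) (F n))
        + cmod (L2_inner \<Omega> p q (mult_op (indicator (cball c (s n))) g) (F n))"
      using lower[of n] norm_triangle_ineq order_trans by metis
    then show ?thesis
      using L2_Cauchy_Schwarz[OF form_diff_L2[OF TL gL] FL[of n]] L2_Cauchy_Schwarz[OF iL FL[of n]]
      by (simp add: F(2))
  qed
  have "(\<lambda>j. L2_norm \<Omega> p q (mult_op (indicator (cball c (s (k j)))) g)) \<longlonglongrightarrow> 0"
    using LIMSEQ_subseq_LIMSEQ[OF L2_norm_shrinking_balls_tendsto[OF op gL s_lim] k] by (simp add: o_def)
  from tendsto_add[OF lim this] have "cmod (\<phi> c) / 2 \<le> 0 + 0"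
    by (rule tendsto_lowerbound) (use upper in auto)
  then show False using nz by simp
qed

lemma toeplitz_op_K2:
  assumes "bounded \<Omega>" "open \<Omega>" "\<phi> \<in> Linfty \<Omega>" "f \<in> K2 \<Omega> p q"
  shows "toeplitz_op \<Omega> p q \<phi> f \<in> K2 \<Omega> p q"
    and "h \<in> K2 \<Omega> p q \<Longrightarrow> L2_inner \<Omega> p q (toeplitz_op \<Omega> p q \<phi> f) h = L2_inner \<Omega> p q (mult_op \<phi> f) h"
  using proj_K2[OF assms(1,2) mult_op_L2[OF K2_imp_L2[OF assms(4)] assms(3)]]
  by (simp_all add: toeplitz_op_def)

text \<open>Stated with vanishing norms, since the representatives need not be 0: \<phi> may be
  nonzero off \<Omega>, and the projection is an arbitrary choice.\<close>

lemma compact_op_null: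
  fixes V W :: "('n::finite) form set"
  assumes "T ` V \<subseteq> W" "(\<lambda>z I J. 0) \<in> W" and null: "\<And>f. f \<in> V \<Longrightarrow> L2_norm \<Omega> p q (T f) = 0"
  shows "compact_op \<Omega> p q V W T"
  unfolding compact_op_def
proof (intro conjI allI impI assms(1) bexI[OF _ assms(2)] exI[of _ "\<lambda>j. j"])
  fix F :: "nat \<Rightarrow> 'n form" and C assume F: "\<forall>j. F j \<in> V \<and> L2_norm \<Omega> p q (F j) \<le> C"
  have "form_diff h (\<lambda>z I J. 0) = h" for h :: "'n form" by (simp add: form_diff_def)
  then show "(\<lambda>j. L2_norm \<Omega> p q (form_diff (T (F j)) (\<lambda>z I J. 0))) \<longlonglongrightarrow> 0"
    using F null by simp
qed (simp add: strict_mono_def)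

theorem corollary1:
  fixes \<Omega> :: "('n::{finite,linorder}) cspace set"
    and p q :: nat and \<phi> :: "'n cspace \<Rightarrow> complex"
  assumes "bounded \<Omega>" and "pseudoconvex_domain \<Omega>"
    and "p \<le> CARD('n)" and "1 \<le> q" and "q \<le> CARD('n)"
    and "continuous_on \<Omega> \<phi>" and "\<phi> \<in> Linfty \<Omega>"
  shows "(compact_op \<Omega> p q (K2 \<Omega> p q) (L2 \<Omega> p q) (mult_op \<phi>)
            \<longleftrightarrow> compact_op \<Omega> p q (K2 \<Omega> p q) (K2 \<Omega> p q) (toeplitz_op \<Omega> p q \<phi>))
       \<and> (compact_op \<Omega> p q (K2 \<Omega> p q) (K2 \<Omega> p q) (toeplitz_op \<Omega> p q \<phi>)
            \<longleftrightarrow> (\<forall>z\<in>\<Omega>. \<phi> z = 0))"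
proof -
  have op: "open \<Omega>" using assms(2) by (simp add: pseudoconvex_domain_def)
  note symbol_eq_0 = compact_op_symbol_eq_0[OF assms(1) op assms(3-7)]
  have "\<forall>z\<in>\<Omega>. \<phi> z = 0" if "compact_op \<Omega> p q (K2 \<Omega> p q) (L2 \<Omega> p q) (mult_op \<phi>)"
    using symbol_eq_0[OF that] by blast
  \<comment> \<open>Since f itself is closed, the projection identity may be tested with h = f,
    which gives the diagonal values.\<close>
  moreover have "\<forall>z\<in>\<Omega>. \<phi> z = 0"
    if "compact_op \<Omega> p q (K2 \<Omega> p q) (K2 \<Omega> p q) (toeplitz_op \<Omega> p q \<phi>)"
    using symbol_eq_0[OF that] toeplitz_op_K2(2)[OF assms(1) op assms(7)] K2_imp_L2 by blast
  moreover have "compact_op \<Omega> p q (K2 \<Omega> p q) (L2 \<Omega> p q) (mult_op \<phi>) \<and>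
      compact_op \<Omega> p q (K2 \<Omega> p q) (K2 \<Omega> p q) (toeplitz_op \<Omega> p q \<phi>)" if zero: "\<forall>z\<in>\<Omega>. \<phi> z = 0"
  proof -
    have mL: "mult_op \<phi> f \<in> L2 \<Omega> p q" if "f \<in> K2 \<Omega> p q" for f
      using mult_op_L2[OF K2_imp_L2[OF that] assms(7)] .
    have m0: "L2_norm \<Omega> p q (mult_op \<phi> f) = 0" if "f \<in> K2 \<Omega> p q" for f
    proof -
      have "L2_norm \<Omega> p q (mult_op \<phi> f) \<le> 0 * L2_norm \<Omega> p q f"
        using zero that by (intro L2_norm_le_pointwise mL K2_imp_L2) (auto simp: mult_op_def)
      then show ?thesis using L2_norm_nonneg[of \<Omega> p q "mult_op \<phi> f"] by linarith
    qed
    have "L2_norm \<Omega> p q (toeplitz_op \<Omega> p q \<phi> f) = 0" if f: "f \<in> K2 \<Omega> p q" for f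
    proof -
      note T = toeplitz_op_K2[OF assms(1) op assms(7) f]
      \<comment> \<open>The squared norm of T f equals <\<phi> f, T f>, because T f is an admissible
        test form; Cauchy-Schwarz bounds this by the norm of \<phi> f, which is 0, times that of T
        f.\<close>
      have "complex_of_real ((L2_norm \<Omega> p q (toeplitz_op \<Omega> p q \<phi> f))\<^sup>2) = 0"
        using L2_Cauchy_Schwarz[OF mL[OF f] K2_imp_L2[OF T(1)]] T(2)[OF T(1)] m0[OF f]
        unfolding L2_inner_self by simp
      then show ?thesis by simp
    qed
    then show ?thesis
      using mL m0 toeplitz_op_K2(1)[OF assms(1) op assms(7)] zero_form_K2 K2_imp_L2
      by (intro conjI compact_op_null) blast+
  qed
  ultimately show ?thesis by blast
qed

end
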